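(* Let $d\ge1$ and $1\le k<d(d+1)$. If $G=(V,E)$ is a $k$-connected graph that is not rigid in $\mathbb{R}^d$, then $r_d(G)\ge m_{d,k}|V|$, where $m_{d,k}=\frac{k}{2}$ if $1\le k\le d$ and $m_{d,k}=d+\frac12-\frac12\cdot\frac{d(d+1)}{k}$ if $d+1\le k<d(d+1)$.
   Context: $r_d(G)$ is the rank of the $d$-dimensional rigidity matroid of $G$: the rank of the rigidity matrix of a generic framework $(G,p)$ in $\mathbb{R}^d$ (coordinates algebraically independent over $\mathbb{Q}$), whose row for edge $uv$ has $p(u)-p(v)$ in the $d$ columns of $u$, $p(v)-p(u)$ in those of $v$, zeros elsewhere. A graph is rigid in $\mathbb{R}^d$ if a generic framework of it is rigid, i.e. there is $\varepsilon>0$ such that every framework with the same edge lengths and each vertex moved by less than $\varepsilon$ has all pairwise distances unchanged. *)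

theory Defs
  imports "HOL-Analysis.Analysis"
begin

text \<open>
  The vertex set of a graph is the finite type \<open>'v\<close>, its edges are two-element subsets of \<open>'v\<close>,
  and the dimension is \<open>CARD('d)\<close>.
\<close>

definition simple_graph :: "'v set set \<Rightarrow> bool" where
  "simple_graph E \<longleftrightarrow> (\<forall>e\<in>E. card e = 2)"

definition induced_connected :: "'v set set \<Rightarrow> 'v set \<Rightarrow> bool" where
  "induced_connected E W \<longleftrightarrow>
     W \<noteq> {} \<and> (\<forall>u\<in>W. \<forall>v\<in>W. (u, v) \<in> {(x, y). x \<in> W \<and> y \<in> W \<and> {x, y} \<in> E}\<^sup>*)"

definition vertex_connected :: "nat \<Rightarrow> 'v::finite set set \<Rightarrow> bool" where
  "vertex_connected k E \<longleftrightarrow>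
     k < CARD('v) \<and> (\<forall>S :: 'v set. card S < k \<longrightarrow> induced_connected E (- S))"

text \<open>
  A polynomial with rational coefficients in the variables \<open>'i\<close> is given by a finite set \<open>M\<close> of
  exponent vectors and a coefficient \<open>c m\<close> for each \<open>m \<in> M\<close>.
\<close>

definition alg_independent_rat :: "('i::finite \<Rightarrow> real) \<Rightarrow> bool" where
  "alg_independent_rat x \<longleftrightarrow>
     (\<forall>(M :: ('i \<Rightarrow> nat) set) (c :: ('i \<Rightarrow> nat) \<Rightarrow> rat).
        finite M \<longrightarrow> (\<Sum>m\<in>M. of_rat (c m) * (\<Prod>i\<in>UNIV. x i ^ m i)) = 0 \<longrightarrow>
        (\<forall>m\<in>M. c m = 0))"

definition generic_placement :: "('v::finite \<Rightarrow> real ^ 'd) \<Rightarrow> bool" where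
  "generic_placement p \<longleftrightarrow> alg_independent_rat (\<lambda>(v, i). p v $ i)"

text \<open>
  Rows are indexed by all sets of vertices; those that are not edges give zero rows, which do not
  affect the rank. In the row of an edge \<open>e\<close> containing \<open>w\<close>, the description picks the other end of \<open>e\<close>.
\<close>

definition rigidity_matrix ::
  "'v::finite set set \<Rightarrow> ('v \<Rightarrow> real ^ 'd) \<Rightarrow> real ^ ('v \<times> 'd) ^ ('v set)" where
  "rigidity_matrix E p =
     (\<chi> e. \<chi> c. case c of (w, i) \<Rightarrow>
        if e \<in> E \<and> w \<in> e then (p w - p (THE u. e = {w, u})) $ i else 0)"

text \<open>The rank does not depend on the choice of the generic placement.\<close>

definition rigidity_rank :: "'d::finite itself \<Rightarrow> 'v::finite set set \<Rightarrow> nat" where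
  "rigidity_rank _ E =
     rank (rigidity_matrix E (SOME p :: 'v \<Rightarrow> real ^ 'd. generic_placement p))"

definition rigid_framework :: "'v set set \<Rightarrow> ('v \<Rightarrow> real ^ 'd) \<Rightarrow> bool" where
  "rigid_framework E p \<longleftrightarrow>
     (\<exists>\<epsilon>>0. \<forall>q :: 'v \<Rightarrow> real ^ 'd.
        (\<forall>u v. {u, v} \<in> E \<longrightarrow> dist (q u) (q v) = dist (p u) (p v)) \<and>
        (\<forall>v. dist (q v) (p v) < \<epsilon>) \<longrightarrow>
        (\<forall>u v. dist (q u) (q v) = dist (p u) (p v)))"

definition rigid_graph :: "'d::finite itself \<Rightarrow> 'v::finite set set \<Rightarrow> bool" where
  "rigid_graph _ E \<longleftrightarrow> (\<exists>p :: 'v \<Rightarrow> real ^ 'd. generic_placement p \<and> rigid_framework E p)"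

definition rank_density :: "nat \<Rightarrow> nat \<Rightarrow> real" where
  "rank_density d k =
     (if k \<le> d then real k / 2
      else real d + 1 / 2 - 1 / 2 * (real (d * (d + 1)) / real k))"

end

theory Submission
  imports Defs
begin

text \<open>
  Fix a generic placement \<open>p\<close> and pass to the closure of the graph, joining two vertices whenever
  their row lies in the span of the rows of \<open>E\<close>; this changes neither the rank nor non-rigidity and keeps
  \<open>k\<close>-connectivity. In the closure two cliques with at least \<open>d\<close> common vertices merge into one.

  Add the vertices one at a time in a uniformly random order. A vertex whose set of earlier neighbours
  is \<open>A\<close> raises the rank by at least \<open>min |A| d\<close> (0-extension), and by \<open>d + 1\<close> if \<open>|A| > d\<close> and \<open>A\<close> is not a
  clique (1-extension). Given \<open>|A| = j\<close>, which is uniform on \<open>0, ..., D\<close> for a vertex of degree \<open>D\<close>, the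
  set \<open>A\<close> is a random \<open>j\<close>-subset of the neighbourhood; if the neighbourhood is not a clique and \<open>j > d\<close>,
  then \<open>A\<close> is not a clique with probability at least \<open>j / D\<close>. The resulting expected increase is
  \<open>d + 1/2 - d (d + 1) / (2 D)\<close>, which is at least \<open>m\<^sub>d\<^sub>,\<^sub>k\<close> because \<open>D \<ge> k\<close>. A vertex whose
  neighbourhood is a clique can be removed beforehand: it contributes \<open>d \<ge> m\<^sub>d\<^sub>,\<^sub>k\<close> when it is put back last.
\<close>

section \<open>Rational polynomials and generic points\<close>

definition monomial :: "('i::finite \<Rightarrow> nat) \<Rightarrow> ('i \<Rightarrow> real) \<Rightarrow> real" where
  "monomial m x = (\<Prod>i\<in>UNIV. x i ^ m i)"

definition rat_poly_eval ::
  "('i::finite \<Rightarrow> nat) set \<Rightarrow> (('i \<Rightarrow> nat) \<Rightarrow> rat) \<Rightarrow> ('i \<Rightarrow> real) \<Rightarrow> real" where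
  "rat_poly_eval M c x = (\<Sum>m\<in>M. of_rat (c m) * monomial m x)"

definition rat_poly :: "(('i::finite \<Rightarrow> real) \<Rightarrow> real) \<Rightarrow> bool" where
  "rat_poly f \<longleftrightarrow> (\<exists>M c. finite M \<and> f = rat_poly_eval M c)"

lemma rat_polyI: "finite M \<Longrightarrow> (\<And>x. f x = rat_poly_eval M c x) \<Longrightarrow> rat_poly f"
  unfolding rat_poly_def by blast

lemma rat_polyE:
  assumes "rat_poly f"
  obtains M c where "finite M" "f = rat_poly_eval M c"
  using assms unfolding rat_poly_def by blast

lemma monomial_add: "monomial (\<lambda>i. a i + b i) x = monomial a x * monomial b x"
  by (simp add: monomial_def power_add prod.distrib)

lemma rat_poly_const: "rat_poly (\<lambda>x. of_rat a)"
  by (rule rat_polyI[of "{\<lambda>_. 0}" _ "\<lambda>_. a"]) (auto simp: rat_poly_eval_def monomial_def)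

lemma rat_poly_0 [simp]: "rat_poly (\<lambda>x. 0)" and rat_poly_1 [simp]: "rat_poly (\<lambda>x. 1)"
  using rat_poly_const[of 0] rat_poly_const[of 1] by simp_all

lemma rat_poly_var: "rat_poly (\<lambda>x. x i)"
proof (rule rat_polyI[of "{\<lambda>j. if j = i then 1 else 0}" _ "\<lambda>_. 1"])
  fix x :: "'a \<Rightarrow> real"
  have "(\<Prod>j\<in>UNIV. x j ^ (if j = i then 1 else 0)) = (\<Prod>j\<in>UNIV. if j = i then x j else 1)"
    by (intro prod.cong) auto
  then show "x i = rat_poly_eval {\<lambda>j. if j = i then 1 else 0} (\<lambda>_. 1) x"
    by (simp add: rat_poly_eval_def monomial_def)
qed simp

lemma rat_poly_eval_extend:
  assumes "finite M'" "M \<subseteq> M'"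
  shows "rat_poly_eval M c x = rat_poly_eval M' (\<lambda>m. if m \<in> M then c m else 0) x"
  unfolding rat_poly_eval_def using assms by (intro sum.mono_neutral_cong_left) auto

lemma rat_poly_add:
  assumes f: "rat_poly f" and g: "rat_poly g"
  shows "rat_poly (\<lambda>x. f x + g x)"
proof -
  obtain M c where M: "finite M" "f = rat_poly_eval M c"
    using f by (rule rat_polyE)
  obtain M' c' where M': "finite M'" "g = rat_poly_eval M' c'"
    using g by (rule rat_polyE)
  show ?thesis
  proof (rule rat_polyI)
    show fin: "finite (M \<union> M')" using M M' by simp
    show "f x + g x = rat_poly_eval (M \<union> M')
        (\<lambda>m. (if m \<in> M then c m else 0) + (if m \<in> M' then c' m else 0)) x" for x
      unfolding M(2) M'(2) rat_poly_eval_extend[OF fin Un_upper1] rat_poly_eval_extend[OF fin Un_upper2]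
      by (simp only: rat_poly_eval_def of_rat_add distrib_right sum.distrib)
  qed
qed

lemma rat_poly_sum: "(\<And>k. k \<in> K \<Longrightarrow> rat_poly (f k)) \<Longrightarrow> rat_poly (\<lambda>x. \<Sum>k\<in>K. f k x)"
  by (induction K rule: infinite_finite_induct) (auto intro: rat_poly_add)

lemma rat_poly_mult_term:
  assumes "rat_poly f"
  shows "rat_poly (\<lambda>x. of_rat b * monomial m x * f x)"
proof -
  obtain M c where M: "finite M" "f = rat_poly_eval M c"
    using assms by (rule rat_polyE)
  have "rat_poly (\<lambda>x. of_rat (b * c n) * monomial (\<lambda>i. m i + n i) x)" for n
    by (rule rat_polyI[of "{\<lambda>i. m i + n i}" _ "\<lambda>_. b * c n"]) (auto simp: rat_poly_eval_def)
  then have "rat_poly (\<lambda>x. \<Sum>n\<in>M. of_rat (b * c n) * monomial (\<lambda>i. m i + n i) x)"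
    by (intro rat_poly_sum)
  then show ?thesis
    unfolding M(2) rat_poly_eval_def
    by (simp add: monomial_add of_rat_mult sum_distrib_left mult_ac)
qed

lemma rat_poly_mult:
  assumes f: "rat_poly f" and g: "rat_poly g"
  shows "rat_poly (\<lambda>x. f x * g x)"
proof -
  obtain M c where M: "finite M" "f = rat_poly_eval M c"
    using f by (rule rat_polyE)
  have "rat_poly (\<lambda>x. \<Sum>m\<in>M. of_rat (c m) * monomial m x * g x)"
    by (intro rat_poly_sum rat_poly_mult_term g)
  then show ?thesis by (simp add: M(2) rat_poly_eval_def sum_distrib_right)
qed

lemma rat_poly_diff:
  assumes "rat_poly f" "rat_poly g"
  shows "rat_poly (\<lambda>x. f x - g x)"
  using rat_poly_add[OF assms(1) rat_poly_mult[OF rat_poly_const[of "-1"] assms(2)]] by simp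

lemma rat_poly_prod: "(\<And>k. k \<in> K \<Longrightarrow> rat_poly (f k)) \<Longrightarrow> rat_poly (\<lambda>x. \<Prod>k\<in>K. f k x)"
  by (induction K rule: infinite_finite_induct) (auto intro: rat_poly_mult)

lemma rat_poly_det:
  fixes A :: "('i::finite \<Rightarrow> real) \<Rightarrow> real^'n^'n"
  assumes "\<And>a b. rat_poly (\<lambda>x. A x $ a $ b)"
  shows "rat_poly (\<lambda>x. det (A x))"
proof -
  have "rat_poly (\<lambda>x. of_int (sign p) :: real)" for p :: "'n \<Rightarrow> 'n"
    using rat_poly_const[of "of_int (sign p)"] by simp
  then show ?thesis
    unfolding det_def by (intro rat_poly_sum rat_poly_mult rat_poly_prod assms)
qed

lemma rat_poly_eq_0_if_alg_independent:
  assumes "rat_poly f" "alg_independent_rat x" "f x = 0"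
  shows "f y = 0"
proof -
  obtain M c where M: "finite M" "f = rat_poly_eval M c"
    using assms(1) by (rule rat_polyE)
  then have "\<forall>m\<in>M. c m = 0"
    using assms(2,3) unfolding alg_independent_rat_def rat_poly_eval_def monomial_def by auto
  then show ?thesis by (simp add: M(2) rat_poly_eval_def)
qed

lemma countable_rat_poly: "countable {f :: ('i::finite \<Rightarrow> real) \<Rightarrow> real. rat_poly f}"
proof (rule countable_subset)
  let ?F = "\<Union>M\<in>Collect finite. rat_poly_eval M ` (M \<rightarrow>\<^sub>E UNIV) :: (('i \<Rightarrow> real) \<Rightarrow> real) set"
  show "{f. rat_poly f} \<subseteq> ?F"
  proof clarify
    fix f :: "('i \<Rightarrow> real) \<Rightarrow> real" assume "rat_poly f"
    then obtain M c where M: "finite M" "f = rat_poly_eval M c" by (rule rat_polyE)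
    then have "f = rat_poly_eval M (restrict c M)" by (simp add: rat_poly_eval_def fun_eq_iff)
    then have "f \<in> rat_poly_eval M ` (M \<rightarrow>\<^sub>E UNIV)" by simp
    then show "f \<in> ?F" using M(1) by blast
  qed
  show "countable ?F"
    by (rule countable_UN[OF countable_Collect_finite]) (simp add: countable_PiE)
qed

definition rat_independent_on :: "'i set \<Rightarrow> ('i::finite \<Rightarrow> real) \<Rightarrow> bool" where
  "rat_independent_on I x \<longleftrightarrow> (\<forall>M c. finite M \<longrightarrow> (\<forall>m\<in>M. \<forall>i. i \<notin> I \<longrightarrow> m i = 0) \<longrightarrow>
     rat_poly_eval M c x = 0 \<longrightarrow> (\<forall>m\<in>M. c m = 0))"

lemma rat_independent_onD:
  "\<lbrakk>rat_independent_on I x; finite M; \<And>m i. m \<in> M \<Longrightarrow> i \<notin> I \<Longrightarrow> m i = 0; rat_poly_eval M c x = 0; m \<in> M\<rbrakk>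
    \<Longrightarrow> c m = 0"
  unfolding rat_independent_on_def by blast

lemma rat_independent_on_UNIV_iff: "rat_independent_on UNIV x \<longleftrightarrow> alg_independent_rat x"
  by (simp add: rat_independent_on_def alg_independent_rat_def rat_poly_eval_def monomial_def)

lemma rat_independent_on_empty: "rat_independent_on {} x"
  unfolding rat_independent_on_def
proof (intro allI impI ballI)
  fix M :: "('a \<Rightarrow> nat) set" and c m
  assume M: "\<forall>m\<in>M. \<forall>i. i \<notin> {} \<longrightarrow> m i = 0" and m: "m \<in> M" and eval: "rat_poly_eval M c x = 0"
  have "n = (\<lambda>_. 0)" if "n \<in> M" for n using M that by (auto simp: fun_eq_iff)
  then have "M = {m}" "m = (\<lambda>_. 0)" using m by auto
  then show "c m = 0" using eval by (simp add: rat_poly_eval_def monomial_def)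
qed

lemma monomial_fun_upd: "monomial m (x(i := t)) = monomial (m(i := 0)) x * t ^ m i"
proof -
  have "monomial m (x(i := t)) = t ^ m i * (\<Prod>k\<in>UNIV - {i}. (x(i := t)) k ^ m k)"
    unfolding monomial_def by (subst prod.remove[of UNIV i]) auto
  also have "(\<Prod>k\<in>UNIV - {i}. (x(i := t)) k ^ m k) = (\<Prod>k\<in>UNIV - {i}. x k ^ (m(i := 0)) k)"
    by (intro prod.cong) auto
  also have "\<dots> = monomial (m(i := 0)) x"
    unfolding monomial_def by (simp add: prod.remove[of UNIV i])
  finally show ?thesis by (simp only: mult.commute)
qed

lemma rat_poly_eval_fun_upd:
  assumes M: "finite M" "\<And>m. m \<in> M \<Longrightarrow> m i \<le> n"
  shows "rat_poly_eval M c (x(i := t)) =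
    (\<Sum>e\<le>n. rat_poly_eval ((\<lambda>m. m(i := 0)) ` {m \<in> M. m i = e}) (\<lambda>m. c (m(i := e))) x * t ^ e)"
proof -
  have coeff: "rat_poly_eval ((\<lambda>m. m(i := 0)) ` {m \<in> M. m i = e}) (\<lambda>m. c (m(i := e))) x =
    (\<Sum>m\<in>{m \<in> M. m i = e}. of_rat (c m) * monomial (m(i := 0)) x)" for e
  proof -
    have "inj_on (\<lambda>m. m(i := 0)) {m \<in> M. m i = e}"
      by (rule inj_onI) (metis (mono_tags, lifting) fun_upd_triv fun_upd_upd mem_Collect_eq)
    then show ?thesis
      unfolding rat_poly_eval_def by (subst sum.reindex) (auto intro!: sum.cong)
  qed
  have "rat_poly_eval M c (x(i := t)) = (\<Sum>m\<in>M. of_rat (c m) * monomial (m(i := 0)) x * t ^ m i)"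
    unfolding rat_poly_eval_def monomial_fun_upd by (simp add: mult.assoc)
  also have "\<dots> = (\<Sum>e\<le>n. \<Sum>m\<in>{m \<in> M. m i = e}. of_rat (c m) * monomial (m(i := 0)) x * t ^ m i)"
    using M by (intro sum.group[symmetric]) auto
  also have "\<dots> = (\<Sum>e\<le>n. (\<Sum>m\<in>{m \<in> M. m i = e}. of_rat (c m) * monomial (m(i := 0)) x) * t ^ e)"
    unfolding sum_distrib_right by (intro sum.cong) auto
  finally show ?thesis unfolding coeff .
qed

lemma finite_roots_rat_poly_eval_fun_upd:
  assumes x: "rat_independent_on I x" and M: "finite M" "\<And>m k. m \<in> M \<Longrightarrow> k \<notin> insert i I \<Longrightarrow> m k = 0"
    and m: "m \<in> M" "c m \<noteq> 0"
  shows "finite {t. rat_poly_eval M c (x(i := t)) = 0}"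
proof -
  define coeff where
    "coeff e = rat_poly_eval ((\<lambda>m. m(i := 0)) ` {m \<in> M. m i = e}) (\<lambda>m. c (m(i := e))) x" for e
  have bound: "l i \<le> Max ((\<lambda>m. m i) ` M)" if "l \<in> M" for l using that M(1) by simp
  have "coeff (m i) \<noteq> 0"
  proof
    assume "coeff (m i) = 0"
    then have "c ((m(i := 0))(i := m i)) = 0"
      unfolding coeff_def using M m
      by (intro rat_independent_onD[OF x, of "(\<lambda>l. l(i := 0)) ` {l \<in> M. l i = m i}"
            "\<lambda>l. c (l(i := m i))"]) auto
    then show False using m by simp
  qed
  then have "finite {t. (\<Sum>e\<le>Max ((\<lambda>m. m i) ` M). coeff e * t ^ e) = 0}"
    using bound[OF m(1)] by (subst polyfun_finite_roots) auto
  moreover have "rat_poly_eval M c (x(i := t)) = (\<Sum>e\<le>Max ((\<lambda>m. m i) ` M). coeff e * t ^ e)" for t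
    unfolding coeff_def by (rule rat_poly_eval_fun_upd[OF M(1) bound])
  ultimately show ?thesis by (simp only:)
qed

text \<open>The new coordinate has to avoid the finitely many roots of each of countably many polynomials.\<close>

lemma rat_independent_on_insert:
  assumes x: "rat_independent_on I x"
  shows "\<exists>t. rat_independent_on (insert i I) (x(i := t))"
proof -
  define roots where "roots f = {t. f (x(i := t)) = 0}" for f :: "('a \<Rightarrow> real) \<Rightarrow> real"
  have "countable (\<Union>f\<in>{f. rat_poly f \<and> finite (roots f)}. roots f)"
    by (intro countable_UN countable_subset[OF _ countable_rat_poly]) (auto intro: countable_finite)
  then have "(\<Union>f\<in>{f. rat_poly f \<and> finite (roots f)}. roots f) \<noteq> UNIV"
    using uncountable_UNIV_real by auto
  then obtain t where t: "\<And>f. rat_poly f \<Longrightarrow> finite (roots f) \<Longrightarrow> t \<notin> roots f"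
    by blast
  have "c m = 0"
    if M: "finite M" "\<forall>m\<in>M. \<forall>k. k \<notin> insert i I \<longrightarrow> m k = 0"
      and eval: "rat_poly_eval M c (x(i := t)) = 0" and m: "m \<in> M" for M c m
  proof (rule ccontr)
    assume "c m \<noteq> 0"
    then have "finite (roots (rat_poly_eval M c))"
      unfolding roots_def using M m by (intro finite_roots_rat_poly_eval_fun_upd[OF x]) auto
    then have "t \<notin> roots (rat_poly_eval M c)"
      using M(1) by (intro t) (auto intro: rat_polyI)
    then show False using eval by (simp add: roots_def)
  qed
  then show ?thesis unfolding rat_independent_on_def by blast
qed

lemma ex_alg_independent_rat: "\<exists>x :: 'i::finite \<Rightarrow> real. alg_independent_rat x"
proof -
  have "\<exists>x :: 'i \<Rightarrow> real. rat_independent_on I x" for I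
    using finite[of I]
    by (induction I rule: finite_induct)
      (use rat_independent_on_empty rat_independent_on_insert in blast)+
  then show ?thesis by (metis rat_independent_on_UNIV_iff)
qed

section \<open>Generic rank and semicontinuity of the rank\<close>

definition indep_family :: "'k set \<Rightarrow> ('k \<Rightarrow> 'a::real_vector) \<Rightarrow> bool" where
  "indep_family K a \<longleftrightarrow> (\<forall>c. (\<Sum>k\<in>K. c k *\<^sub>R a k) = 0 \<longrightarrow> (\<forall>k\<in>K. c k = 0))"

lemma indep_familyD: "indep_family K a \<Longrightarrow> (\<Sum>k\<in>K. c k *\<^sub>R a k) = 0 \<Longrightarrow> k \<in> K \<Longrightarrow> c k = 0"
  unfolding indep_family_def by blast

lemma indep_family_imp_inj_on:
  assumes "finite K" and indep: "indep_family K a"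
  shows "inj_on a K"
proof (rule inj_onI, rule ccontr)
  fix k l assume kl: "k \<in> K" "l \<in> K" "a k = a l" "k \<noteq> l"
  let ?c = "\<lambda>i. if i = k then 1 else if i = l then - 1 else 0 :: real"
  have "(\<Sum>i\<in>K. ?c i *\<^sub>R a i) = (\<Sum>i\<in>{k, l}. ?c i *\<^sub>R a i)"
    using assms(1) kl by (intro sum.mono_neutral_right) auto
  also have "\<dots> = 0" using kl by simp
  finally have "?c k = 0" using indep_familyD[OF indep, of ?c] kl(1) by blast
  then show False by simp
qed

lemma indep_family_iff_inj_on_independent:
  assumes "finite K"
  shows "indep_family K a \<longleftrightarrow> inj_on a K \<and> independent (a ` K)"
proof (intro iffI conjI)
  assume indep: "indep_family K a"
  show inj: "inj_on a K" by (rule indep_family_imp_inj_on[OF assms indep])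
  show "independent (a ` K)"
  proof (rule independent_if_scalars_zero)
    fix f x assume "(\<Sum>x\<in>a ` K. f x *\<^sub>R x) = 0" and x: "x \<in> a ` K"
    then have "(\<Sum>k\<in>K. f (a k) *\<^sub>R a k) = 0" by (simp add: sum.reindex[OF inj])
    then show "f x = 0" using indep x unfolding indep_family_def by auto
  qed (use assms in auto)
next
  assume inj_indep: "inj_on a K \<and> independent (a ` K)"
  show "indep_family K a"
    unfolding indep_family_def
  proof (intro allI impI ballI)
    fix c k assume c: "(\<Sum>k\<in>K. c k *\<^sub>R a k) = 0" and k: "k \<in> K"
    have "(\<Sum>x\<in>a ` K. c (inv_into K a x) *\<^sub>R x) = 0"
      using c inj_indep by (simp add: sum.reindex cong: sum.cong)
    then have "c (inv_into K a (a k)) = 0"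
      using inj_indep assms k by (intro independentD[of "a ` K" "a ` K" "\<lambda>x. c (inv_into K a x)"]) auto
    then show "c k = 0" using inj_indep k by simp
  qed
qed

lemma indep_family_iff_dim:
  fixes a :: "'k \<Rightarrow> 'a::euclidean_space"
  assumes "finite K"
  shows "indep_family K a \<longleftrightarrow> dim (a ` K) = card K"
proof
  assume "indep_family K a"
  then show "dim (a ` K) = card K"
    using assms by (simp add: indep_family_iff_inj_on_independent dim_eq_card_independent card_image)
next
  assume dim: "dim (a ` K) = card K"
  moreover have "dim (a ` K) \<le> card (a ` K)"
    using assms by (intro dim_le_card) (auto intro: span_base)
  ultimately have card: "card (a ` K) = card K" using card_image_le[OF assms, of a] by simp
  then have "independent (a ` K)"
    using assms dim by (intro card_le_dim_spanning[of _ "a ` K"]) (auto intro: span_base)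
  then show "indep_family K a"
    using assms card by (simp add: indep_family_iff_inj_on_independent eq_card_imp_inj_on)
qed

text \<open>The padding by the identity makes the Gram matrix of the vectors in \<open>K\<close> indexed by the whole type.\<close>

definition gram :: "'k::finite set \<Rightarrow> ('k \<Rightarrow> 'a::real_inner) \<Rightarrow> real^'k^'k" where
  "gram K a = (\<chi> k l. if k \<in> K \<and> l \<in> K then a k \<bullet> a l else if k = l then 1 else 0)"

lemma gram_mult_vec_nth:
  "(gram K a *v c) $ k = (if k \<in> K then a k \<bullet> (\<Sum>l\<in>K. c $ l *\<^sub>R a l) else c $ k)"
proof (cases "k \<in> K")
  case True
  have "(gram K a *v c) $ k = (\<Sum>l\<in>UNIV. if l \<in> K then (a k \<bullet> a l) * c $ l else 0)"
    unfolding matrix_vector_mult_def using True by (auto simp: gram_def intro!: sum.cong)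
  also have "\<dots> = (\<Sum>l\<in>K. (a k \<bullet> a l) * c $ l)"
    by (simp add: sum.If_cases)
  finally show ?thesis using True by (simp add: inner_sum_right mult.commute)
next
  case False
  have "(gram K a *v c) $ k = (\<Sum>l\<in>UNIV. if k = l then c $ l else 0)"
    unfolding matrix_vector_mult_def vec_lambda_beta using False
    by (intro sum.cong) (auto simp: gram_def)
  then show ?thesis using False by simp
qed

lemma gram_mult_vec_eq_0_iff:
  "gram K a *v c = 0 \<longleftrightarrow> (\<forall>k. k \<notin> K \<longrightarrow> c $ k = 0) \<and> (\<Sum>k\<in>K. c $ k *\<^sub>R a k) = 0"
proof -
  let ?s = "\<Sum>k\<in>K. c $ k *\<^sub>R a k"
  have "?s = 0" if "\<forall>k\<in>K. a k \<bullet> ?s = 0"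
  proof -
    have "?s \<bullet> ?s = 0" using that by (subst (1) inner_sum_left) simp
    then show ?thesis by simp
  qed
  then show ?thesis by (auto simp: vec_eq_iff[of "_ *v _"] gram_mult_vec_nth)
qed

lemma det_gram_nz_iff: "det (gram K a) \<noteq> 0 \<longleftrightarrow> indep_family K a"
proof -
  have "det (gram K a) \<noteq> 0 \<longleftrightarrow> (\<forall>c. gram K a *v c = 0 \<longrightarrow> c = 0)"
    using invertible_det_nz[of "gram K a"] invertible_left_inverse[of "gram K a"]
      matrix_left_invertible_ker[of "gram K a"] by simp
  also have "\<dots> \<longleftrightarrow> indep_family K a"
  proof
    assume ker: "\<forall>c. gram K a *v c = 0 \<longrightarrow> c = 0"
    show "indep_family K a"
      unfolding indep_family_def
    proof (intro allI impI)
      fix c assume "(\<Sum>k\<in>K. c k *\<^sub>R a k) = 0"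
      then have "gram K a *v (\<chi> k. if k \<in> K then c k else 0) = 0"
        by (simp add: gram_mult_vec_eq_0_iff cong: sum.cong)
      then have "(\<chi> k. if k \<in> K then c k else 0) $ k = 0" for k
        using ker by (metis zero_index)
      then show "\<forall>k\<in>K. c k = 0" unfolding vec_lambda_beta by metis
    qed
  next
    assume indep: "indep_family K a"
    show "\<forall>c. gram K a *v c = 0 \<longrightarrow> c = 0"
    proof (intro allI impI)
      fix c assume c: "gram K a *v c = 0"
      then have "c $ k = 0" for k
        using indep_familyD[OF indep, of "($) c" k]
        by (cases "k \<in> K") (auto simp: gram_mult_vec_eq_0_iff)
      then show "c = 0" by (simp add: vec_eq_iff)
    qed
  qed
  finally show ?thesis .
qed

lemma card_le_dim_if_det_gram_nz:
  fixes a :: "'k::finite \<Rightarrow> 'a::euclidean_space"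
  assumes "det (gram J a) \<noteq> 0" "J \<subseteq> K"
  shows "card J \<le> dim (a ` K)"
proof -
  have "dim (a ` J) = card J" using assms(1) by (simp add: det_gram_nz_iff indep_family_iff_dim)
  then show ?thesis using assms(2) by (metis dim_subset image_mono)
qed

lemma det_gram_nz_of_basis:
  fixes a :: "'k::finite \<Rightarrow> 'a::euclidean_space"
  obtains J where "J \<subseteq> K" "det (gram J a) \<noteq> 0" "card J = dim (a ` K)"
proof -
  obtain B where B: "B \<subseteq> a ` K" "independent B" "card B = dim (a ` K)"
    using basis_exists[of "a ` K"] by metis
  obtain J where J: "J \<subseteq> K" "inj_on a J" "a ` J = B"
    using subset_image_inj[of B a K] B(1) by auto
  have "det (gram J a) \<noteq> 0"
    using J B by (simp add: det_gram_nz_iff indep_family_iff_inj_on_independent)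
  then show ?thesis using that J B card_image by metis
qed

lemma tendsto_det:
  fixes A :: "'x \<Rightarrow> real^'n^'n"
  assumes "(A \<longlongrightarrow> L) F"
  shows "((\<lambda>x. det (A x)) \<longlongrightarrow> det L) F"
  unfolding det_def by (intro tendsto_intros assms)

lemma tendsto_gram:
  assumes "\<And>k. ((\<lambda>x. a x k) \<longlongrightarrow> b k) F"
  shows "((\<lambda>x. gram K (a x)) \<longlongrightarrow> gram K b) F"
proof -
  have "((\<lambda>x. if k \<in> K \<and> l \<in> K then a x k \<bullet> a x l else if k = l then 1 else 0)
      \<longlongrightarrow> (if k \<in> K \<and> l \<in> K then b k \<bullet> b l else if k = l then 1 else 0)) F" for k l
    using assms by (auto intro: tendsto_inner)
  then show ?thesis unfolding gram_def by (intro tendsto_vec_lambda)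
qed

lemma eventually_dim_image_ge:
  fixes a :: "'x \<Rightarrow> 'k::finite \<Rightarrow> 'a::euclidean_space"
  assumes "\<And>k. ((\<lambda>x. a x k) \<longlongrightarrow> b k) F"
  shows "\<forall>\<^sub>F x in F. dim (b ` K) \<le> dim (a x ` K)"
proof -
  obtain J where J: "J \<subseteq> K" "det (gram J b) \<noteq> 0" "card J = dim (b ` K)"
    by (rule det_gram_nz_of_basis)
  have "\<forall>\<^sub>F x in F. det (gram J (a x)) \<noteq> 0"
    using tendsto_imp_eventually_ne[OF tendsto_det[OF tendsto_gram[OF assms]] J(2)] .
  then show ?thesis
    by eventually_elim (use card_le_dim_if_det_gram_nz J in metis)
qed

lemma rat_poly_det_gram:
  fixes a :: "('i::finite \<Rightarrow> real) \<Rightarrow> 'k::finite \<Rightarrow> real^'n"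
  assumes "\<And>k n. rat_poly (\<lambda>x. a x k $ n)"
  shows "rat_poly (\<lambda>x. det (gram K (a x)))"
proof (rule rat_poly_det)
  fix k l
  have "rat_poly (\<lambda>x. a x k \<bullet> a x l)"
    unfolding inner_vec_def inner_real_def by (intro rat_poly_sum rat_poly_mult assms)
  then show "rat_poly (\<lambda>x. gram K (a x) $ k $ l)"
    by (cases "k \<in> K \<and> l \<in> K") (auto simp: gram_def)
qed

lemma dim_image_le_alg_independent:
  fixes a :: "('i::finite \<Rightarrow> real) \<Rightarrow> 'k::finite \<Rightarrow> real^'n"
  assumes a: "\<And>k n. rat_poly (\<lambda>x. a x k $ n)" and x: "alg_independent_rat x"
  shows "dim (a y ` K) \<le> dim (a x ` K)"
proof -
  obtain J where J: "J \<subseteq> K" "det (gram J (a y)) \<noteq> 0" "card J = dim (a y ` K)"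
    by (rule det_gram_nz_of_basis)
  have "det (gram J (a x)) \<noteq> 0"
    using rat_poly_eq_0_if_alg_independent[OF rat_poly_det_gram[of a, OF a] x] J(2) by metis
  then show ?thesis using card_le_dim_if_det_gram_nz J by metis
qed

section \<open>Rows of the rigidity matrix\<close>

definition coords :: "('v \<Rightarrow> real^'d) \<Rightarrow> 'v \<times> 'd \<Rightarrow> real" where
  "coords p = (\<lambda>(v, i). p v $ i)"

definition placement :: "('v \<times> 'd \<Rightarrow> real) \<Rightarrow> 'v \<Rightarrow> real^'d" where
  "placement x = (\<lambda>v. \<chi> i. x (v, i))"

lemma placement_coords [simp]: "placement (coords p) = p"
  by (simp add: placement_def coords_def fun_eq_iff vec_eq_iff)

lemma coords_placement [simp]: "coords (placement x) = x"
  by (auto simp: coords_def placement_def)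

lemma generic_placement_iff: "generic_placement p \<longleftrightarrow> alg_independent_rat (coords p)"
  by (simp add: generic_placement_def coords_def)

lemma ex_generic_placement: "\<exists>p :: 'v::finite \<Rightarrow> real^'d. generic_placement p"
  unfolding generic_placement_iff using ex_alg_independent_rat by (metis coords_placement)

lemma dim_image_le_generic:
  fixes a :: "('v::finite \<Rightarrow> real^'d) \<Rightarrow> 'k::finite \<Rightarrow> real^'n"
  assumes "\<And>k n. rat_poly (\<lambda>x. a (placement x) k $ n)" and "generic_placement p"
  shows "dim (a q ` K) \<le> dim (a p ` K)"
  using dim_image_le_alg_independent[of "\<lambda>x. a (placement x)" "coords p" "coords q" K] assms
  by (simp add: generic_placement_iff)

definition at_vertex :: "'v::finite \<Rightarrow> real^'d \<Rightarrow> real^('v \<times> 'd)" where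
  "at_vertex u x = (\<chi> c. if fst c = u then x $ snd c else 0)"

definition vertex_part :: "'v::finite \<Rightarrow> real^('v \<times> 'd) \<Rightarrow> real^'d" where
  "vertex_part u h = (\<chi> i. h $ (u, i))"

definition rigidity_row :: "('v::finite \<Rightarrow> real^'d) \<Rightarrow> 'v \<Rightarrow> 'v \<Rightarrow> real^('v \<times> 'd)" where
  "rigidity_row p u v = at_vertex u (p u - p v) + at_vertex v (p v - p u)"

definition rigidity_rows :: "('v::finite \<Rightarrow> real^'d) \<Rightarrow> ('v \<times> 'v) set \<Rightarrow> (real^('v \<times> 'd)) set" where
  "rigidity_rows p r = (\<lambda>(u, v). rigidity_row p u v) ` r"

lemma linear_at_vertex: "linear (at_vertex u)"
  by (rule linearI) (auto simp: at_vertex_def vec_eq_iff)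

lemma linear_vertex_part: "linear (vertex_part u)"
  by (rule linearI) (auto simp: vertex_part_def vec_eq_iff)

lemma vertex_part_at_vertex: "vertex_part w (at_vertex u x) = (if w = u then x else 0)"
  by (auto simp: vertex_part_def at_vertex_def vec_eq_iff)

lemma vertex_part_rigidity_row:
  "u \<noteq> v \<Longrightarrow> vertex_part w (rigidity_row p u v) =
    (if w = u then p u - p v else if w = v then p v - p u else 0)"
  by (simp add: rigidity_row_def linear_add[OF linear_vertex_part] vertex_part_at_vertex)

lemma inner_at_vertex: "at_vertex u x \<bullet> h = x \<bullet> vertex_part u h"
proof -
  have "at_vertex u x \<bullet> h = (\<Sum>(w, i)\<in>UNIV \<times> UNIV. if w = u then x $ i * h $ (w, i) else 0)"
    unfolding inner_vec_def at_vertex_def UNIV_Times_UNIV by (intro sum.cong) auto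
  also have "\<dots> = (\<Sum>w\<in>UNIV. \<Sum>i\<in>UNIV. if w = u then x $ i * h $ (w, i) else 0)"
    by (rule sum.cartesian_product[symmetric])
  also have "\<dots> = (\<Sum>w\<in>UNIV. if w = u then \<Sum>i\<in>UNIV. x $ i * h $ (w, i) else 0)"
    by (intro sum.cong) auto
  finally show ?thesis by (simp add: inner_vec_def vertex_part_def)
qed

lemma inner_rigidity_row:
  "rigidity_row p u v \<bullet> h = (p u - p v) \<bullet> (vertex_part u h - vertex_part v h)"
  by (simp add: rigidity_row_def inner_add_left inner_at_vertex inner_diff_left inner_diff_right)

lemma rigidity_row_commute: "rigidity_row p u v = rigidity_row p v u"
  by (simp add: rigidity_row_def)

lemma rigidity_row_self [simp]: "rigidity_row p u u = 0"
  by (simp add: rigidity_row_def linear_0[OF linear_at_vertex])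

lemma rigidity_row_in_rows: "(u, v) \<in> r \<Longrightarrow> rigidity_row p u v \<in> rigidity_rows p r"
  by (force simp: rigidity_rows_def)

lemma rigidity_rows_mono: "r \<subseteq> s \<Longrightarrow> rigidity_rows p r \<subseteq> rigidity_rows p s"
  unfolding rigidity_rows_def by (rule image_mono)

definition adjacency :: "'v set set \<Rightarrow> ('v \<times> 'v) set" where
  "adjacency E = {(u, v). {u, v} \<in> E}"

lemma row_rigidity_matrix:
  assumes "{u, v} \<in> E" "u \<noteq> v"
  shows "row {u, v} (rigidity_matrix E p) = rigidity_row p u v"
proof -
  have "(THE w. {u, v} = {u, w}) = v" "(THE w. {u, v} = {v, w}) = u"
    using assms by (auto simp: doubleton_eq_iff)
  then show ?thesis using assms
    by (auto simp: row_def rigidity_matrix_def rigidity_row_def at_vertex_def vec_eq_iff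
        split: prod.split)
qed

lemma rank_rigidity_matrix:
  assumes E: "simple_graph E"
  shows "rank (rigidity_matrix E p) = dim (rigidity_rows p (adjacency E))"
proof -
  have "rigidity_row p u v \<in> rows (rigidity_matrix E p)" if "{u, v} \<in> E" for u v
  proof -
    have "u \<noteq> v" using E that by (auto simp: simple_graph_def)
    then show ?thesis using row_rigidity_matrix[OF that, of p] by (auto simp: rows_def intro: sym)
  qed
  then have "rigidity_rows p (adjacency E) \<subseteq> rows (rigidity_matrix E p)"
    by (auto simp: rigidity_rows_def adjacency_def)
  then have "dim (rigidity_rows p (adjacency E)) \<le> dim (rows (rigidity_matrix E p))"
    by (rule dim_subset)
  moreover have "rows (rigidity_matrix E p) \<subseteq> insert 0 (rigidity_rows p (adjacency E))"
  proof
    fix x assume "x \<in> rows (rigidity_matrix E p)"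
    then obtain e where x: "x = row e (rigidity_matrix E p)" by (auto simp: rows_def)
    show "x \<in> insert 0 (rigidity_rows p (adjacency E))"
    proof (cases "e \<in> E")
      case True
      then obtain u v where "e = {u, v}" "u \<noteq> v"
        using E by (auto simp: simple_graph_def card_2_iff)
      then have "x = rigidity_row p u v" "(u, v) \<in> adjacency E"
        using True x by (simp_all add: row_rigidity_matrix adjacency_def)
      then show ?thesis by (simp add: rigidity_row_in_rows)
    next
      case False
      then show ?thesis by (simp add: x row_def rigidity_matrix_def vec_eq_iff)
    qed
  qed
  then have "dim (rows (rigidity_matrix E p)) \<le> dim (insert 0 (rigidity_rows p (adjacency E)))"
    by (rule dim_subset)
  ultimately show ?thesis by (simp add: row_rank_def dim_insert span_zero)
qed

lemma rat_poly_rigidity_row: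
  fixes u v :: "'v::finite"
  shows "rat_poly (\<lambda>x. rigidity_row (placement x) u v $ c)"
proof -
  have "rat_poly (\<lambda>x. at_vertex w (placement x s - placement x t) $ c)" for w s t :: 'v
    by (cases "fst c = w") (auto simp: at_vertex_def placement_def intro!: rat_poly_diff rat_poly_var)
  then show ?thesis by (simp add: rigidity_row_def rat_poly_add)
qed

lemma dim_rigidity_rows_le_generic:
  fixes p q :: "'v::finite \<Rightarrow> real^'d"
  assumes "generic_placement p"
  shows "dim (rigidity_rows q r) \<le> dim (rigidity_rows p r)"
  unfolding rigidity_rows_def
  using assms by (intro dim_image_le_generic[of "\<lambda>p (u, v). rigidity_row p u v"])
    (auto simp: rat_poly_rigidity_row split: prod.split)

lemma rigidity_rank_eq:
  fixes p :: "'v::finite \<Rightarrow> real^'d"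
  assumes "simple_graph E" and p: "generic_placement p"
  shows "rigidity_rank TYPE('d) E = dim (rigidity_rows p (adjacency E))"
proof -
  have "generic_placement (SOME p :: 'v \<Rightarrow> real^'d. generic_placement p)"
    by (rule someI_ex[OF ex_generic_placement])
  then show ?thesis
    using assms
    by (auto simp: rigidity_rank_def rank_rigidity_matrix intro: antisym dim_rigidity_rows_le_generic)
qed

lemma dim_generic_differences:
  fixes p :: "'v::finite \<Rightarrow> real^'d"
  assumes p: "generic_placement p" and T: "card T \<le> CARD('d)" "v \<notin> T"
  shows "dim ((\<lambda>u. p v - p u) ` T) = card T"
proof (rule antisym)
  obtain \<sigma> :: "'v \<Rightarrow> 'd" where \<sigma>: "inj_on \<sigma> T"
    using card_le_inj[of T "UNIV :: 'd set"] T by auto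
  define q where "q w = (if w \<in> T then - axis (\<sigma> w) 1 else 0 :: real^'d)" for w
  have q: "(\<lambda>u. q v - q u) ` T = (\<lambda>u. axis (\<sigma> u) 1) ` T"
    using T(2) by (intro image_cong) (auto simp: q_def)
  have "inj_on (\<lambda>u. axis (\<sigma> u) (1 :: real)) T"
    using \<sigma> by (auto simp: inj_on_def axis_eq_axis)
  moreover have "independent ((\<lambda>u. axis (\<sigma> u) (1 :: real)) ` T)"
    by (rule independent_mono[OF independent_Basis]) (auto simp: axis_in_Basis_iff)
  ultimately have "card T = dim ((\<lambda>u. q v - q u) ` T)"
    unfolding q by (simp add: dim_eq_card_independent card_image)
  also have "\<dots> \<le> dim ((\<lambda>u. p v - p u) ` T)"
    using p by (intro dim_image_le_generic[of "\<lambda>p u. p v - p u"])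
      (auto simp: placement_def intro!: rat_poly_diff rat_poly_var)
  finally show "card T \<le> dim ((\<lambda>u. p v - p u) ` T)" .
  show "dim ((\<lambda>u. p v - p u) ` T) \<le> card T"
    by (rule order_trans[OF dim_le_card[OF span_superset] card_image_le]) auto
qed

section \<open>Infinitesimal rigidity implies rigidity\<close>

lemma eventually_nhds_fun_iff:
  fixes x :: "'i::finite \<Rightarrow> 'a::metric_space"
  shows "eventually P (nhds x) \<longleftrightarrow> (\<exists>e>0. \<forall>y. (\<forall>i. dist (y i) (x i) < e) \<longrightarrow> P y)"
proof
  assume "eventually P (nhds x)"
  then obtain S where S: "open S" "x \<in> S" "\<And>y. y \<in> S \<Longrightarrow> P y"
    unfolding eventually_nhds by blast
  then obtain X where X: "x \<in> Pi\<^sub>E UNIV X" "\<And>i. open (X i)" "Pi\<^sub>E UNIV X \<subseteq> S"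
    using product_topology_open_contains_basis[of "\<lambda>_. euclidean" UNIV S x]
    unfolding open_fun_def by auto
  have "\<exists>e>0. ball (x i) e \<subseteq> X i" for i
    using X(1) X(2)[of i] open_contains_ball by (metis PiE_mem UNIV_I)
  then obtain e where e: "\<And>i. e i > 0" "\<And>i. ball (x i) (e i) \<subseteq> X i" by metis
  have "P y" if y: "\<forall>i. dist (y i) (x i) < Min (range e)" for y
  proof -
    have "dist (x i) (y i) < e i" for i
      using y[rule_format, of i] Min_le[of "range e" "e i"] by (simp add: dist_commute)
    then have "y i \<in> X i" for i using e(2)[of i] by (auto simp: subset_iff)
    then have "y \<in> Pi\<^sub>E UNIV X" by (simp add: PiE_iff)
    then show ?thesis using X(3) S(3) by blast
  qed
  moreover have "Min (range e) > 0" using e(1) by simp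
  ultimately show "\<exists>e>0. \<forall>y. (\<forall>i. dist (y i) (x i) < e) \<longrightarrow> P y" by blast
next
  assume "\<exists>e>0. \<forall>y. (\<forall>i. dist (y i) (x i) < e) \<longrightarrow> P y"
  then obtain e where e: "e > 0" "\<And>y. (\<forall>i. dist (y i) (x i) < e) \<Longrightarrow> P y" by blast
  define S where "S = {y. \<forall>i\<in>UNIV. y i \<in> ball (x i) e}"
  have "open S"
    unfolding S_def by (rule product_topology_basis'[where x = "\<lambda>i. i"]) simp_all
  moreover have "x \<in> S" using e(1) by (simp add: S_def)
  moreover have "P y" if "y \<in> S" for y
    by (rule e(2)) (use that in \<open>simp add: S_def dist_commute\<close>)
  ultimately show "eventually P (nhds x)" by (auto simp: eventually_nhds intro!: exI[of _ S])
qed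

lemma rigid_framework_iff_eventually:
  fixes p :: "'v::finite \<Rightarrow> real^'d"
  shows "rigid_framework E p \<longleftrightarrow>
    (\<forall>\<^sub>F q in nhds p. (\<forall>u v. {u, v} \<in> E \<longrightarrow> dist (q u) (q v) = dist (p u) (p v)) \<longrightarrow>
      (\<forall>u v. dist (q u) (q v) = dist (p u) (p v)))"
  unfolding rigid_framework_def eventually_nhds_fun_iff
  by (intro ex_cong1 conj_cong refl all_cong1) blast

lemma filterlim_nhds_if_continuous_on_UNIV:
  assumes "continuous_on UNIV f"
  shows "filterlim f (nhds (f x)) (nhds x)"
  using assms by (simp add: continuous_on_def flip: tendsto_at_iff_tendsto_nhds)

lemma bounded_linear_at_vertex: "bounded_linear (at_vertex u)"
  using linear_at_vertex by (simp add: linear_conv_bounded_linear)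

lemma tendsto_rigidity_row: "((\<lambda>q. rigidity_row q u v) \<longlongrightarrow> rigidity_row p u v) (nhds p)"
proof -
  have "((\<lambda>q. q w) \<longlongrightarrow> p w) (nhds p)" for w
    by (rule filterlim_nhds_if_continuous_on_UNIV) simp
  then show ?thesis
    unfolding rigidity_row_def
    by (intro tendsto_add tendsto_diff bounded_linear.tendsto[OF bounded_linear_at_vertex])
qed

lemma eventually_rigidity_rows_subset_span:
  fixes p :: "'v::finite \<Rightarrow> real^'d"
  assumes p: "generic_placement p" and "r \<subseteq> s" and span: "rigidity_rows p s \<subseteq> span (rigidity_rows p r)"
  shows "\<forall>\<^sub>F q in nhds p. rigidity_rows q s \<subseteq> span (rigidity_rows q r)"
proof -
  have "\<forall>\<^sub>F q in nhds p. dim (rigidity_rows p r) \<le> dim (rigidity_rows q r)"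
    unfolding rigidity_rows_def
    by (rule eventually_dim_image_ge) (auto simp: tendsto_rigidity_row split: prod.split)
  then show ?thesis
  proof eventually_elim
    fix q :: "'v \<Rightarrow> real^'d"
    assume le: "dim (rigidity_rows p r) \<le> dim (rigidity_rows q r)"
    have "dim (rigidity_rows q s) \<le> dim (rigidity_rows p s)"
      by (rule dim_rigidity_rows_le_generic[OF p])
    also have "\<dots> \<le> dim (rigidity_rows p r)" using span by (rule dim_mono)
    finally have "span (rigidity_rows q r) = span (rigidity_rows q s)"
      using le rigidity_rows_mono[OF \<open>r \<subseteq> s\<close>, of q]
      by (intro subspace_dim_equal span_mono) auto
    then show "rigidity_rows q s \<subseteq> span (rigidity_rows q r)"
      using span_superset by metis
  qed
qed

definition midpoints :: "('v \<Rightarrow> real^'d) \<Rightarrow> ('v \<Rightarrow> real^'d) \<Rightarrow> 'v \<Rightarrow> real^'d" where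
  "midpoints p q = (\<lambda>v. midpoint (p v) (q v))"

lemma filterlim_midpoints_nhds: "filterlim (midpoints p) (nhds p) (nhds p)"
proof -
  have "continuous_on UNIV (midpoints p)"
    unfolding midpoints_def midpoint_def by (intro continuous_intros continuous_on_product_coordinates)
  moreover have "midpoints p p = p" by (simp add: midpoints_def)
  ultimately show ?thesis using filterlim_nhds_if_continuous_on_UNIV[of "midpoints p" p] by simp
qed

lemma dist_eq_iff_inner_rigidity_row_midpoints:
  fixes p q :: "'v::finite \<Rightarrow> real^'d"
  shows "dist (q u) (q v) = dist (p u) (p v) \<longleftrightarrow>
    rigidity_row (midpoints p q) u v \<bullet> (\<chi> c. coords q c - coords p c) = 0"
proof -
  let ?x = "q u - q v" and ?y = "p u - p v" and ?h = "\<chi> c. coords q c - coords p c"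
  have "vertex_part w ?h = q w - p w" for w
    by (simp add: vertex_part_def coords_def vec_eq_iff)
  moreover have "midpoints p q u - midpoints p q v = (1 / 2) *\<^sub>R (?x + ?y)"
    by (simp add: midpoints_def midpoint_def algebra_simps)
  moreover have "(q u - p u) - (q v - p v) = ?x - ?y" by simp
  ultimately have "rigidity_row (midpoints p q) u v \<bullet> ?h = (1 / 2) * ((?x + ?y) \<bullet> (?x - ?y))"
    by (simp only: inner_rigidity_row inner_scaleR_left)
  also have "(x + y) \<bullet> (x - y) = x \<bullet> x - y \<bullet> y" for x y :: "real^'d"
    by (simp add: inner_add_left inner_diff_right inner_commute[of y x])
  finally have inner: "rigidity_row (midpoints p q) u v \<bullet> ?h = (1 / 2) * (?x \<bullet> ?x - ?y \<bullet> ?y)" .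
  show ?thesis unfolding inner by (simp add: dist_norm norm_eq)
qed

lemma dist_eq_if_midpoints_rows_span:
  fixes p q :: "'v::finite \<Rightarrow> real^'d"
  assumes span: "rigidity_rows (midpoints p q) UNIV \<subseteq> span (rigidity_rows (midpoints p q) (adjacency E))"
    and E: "\<And>u v. {u, v} \<in> E \<Longrightarrow> dist (q u) (q v) = dist (p u) (p v)"
  shows "dist (q u) (q v) = dist (p u) (p v)"
proof -
  let ?m = "midpoints p q" and ?h = "\<chi> c. coords q c - coords p c"
  have "span (rigidity_rows ?m (adjacency E)) \<subseteq> {x. x \<bullet> ?h = 0}"
  proof (rule span_minimal)
    show "rigidity_rows ?m (adjacency E) \<subseteq> {x. x \<bullet> ?h = 0}"
      using E unfolding dist_eq_iff_inner_rigidity_row_midpoints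
      by (auto simp: rigidity_rows_def adjacency_def)
    show "subspace {x. x \<bullet> ?h = 0}" by (simp add: subspace_def inner_add_left)
  qed
  then show ?thesis
    unfolding dist_eq_iff_inner_rigidity_row_midpoints
    using span rigidity_row_in_rows[of u v UNIV ?m] by blast
qed

text \<open>Edge lengths agree at \<open>p\<close> and \<open>q\<close> iff \<open>q - p\<close> is orthogonal to the rows of the edges at the
  midpoints of \<open>p\<close> and \<open>q\<close>, where the rank is still the generic one if \<open>q\<close> is close to \<open>p\<close>.\<close>

lemma rigid_framework_if_rows_span:
  fixes p :: "'v::finite \<Rightarrow> real^'d"
  assumes p: "generic_placement p"
    and span: "rigidity_rows p UNIV \<subseteq> span (rigidity_rows p (adjacency E))"
  shows "rigid_framework E p"
  unfolding rigid_framework_iff_eventually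
  using eventually_compose_filterlim[OF
      eventually_rigidity_rows_subset_span[OF p subset_UNIV span] filterlim_midpoints_nhds]
  by eventually_elim (blast intro: dist_eq_if_midpoints_rows_span)

section \<open>Random subsets and random vertex orders\<close>

definition layer_mean :: "('a set \<Rightarrow> real) \<Rightarrow> 'a set \<Rightarrow> nat \<Rightarrow> real" where
  "layer_mean g N j = (\<Sum>A | A \<subseteq> N \<and> card A = j. g A) / real (card N choose j)"

text \<open>The mean of \<open>g\<close> at the set of earlier neighbours of a vertex with neighbourhood \<open>N\<close> when the
  vertices are ordered uniformly at random.\<close>

definition subset_mean :: "('a set \<Rightarrow> real) \<Rightarrow> 'a set \<Rightarrow> real" where
  "subset_mean g N = (\<Sum>j\<le>card N. layer_mean g N j) / (real (card N) + 1)"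

lemma layer_mean_card: "finite N \<Longrightarrow> layer_mean g N (card N) = g N"
proof -
  assume "finite N"
  then have "{A. A \<subseteq> N \<and> card A = card N} = {N}" by (auto dest: card_subset_eq)
  then show ?thesis by (simp add: layer_mean_def)
qed

lemma layer_mean_add: "layer_mean (\<lambda>A. f A + g A) N j = layer_mean f N j + layer_mean g N j"
  by (simp add: layer_mean_def sum.distrib add_divide_distrib)

lemma layer_mean_cong:
  "(\<And>A. A \<subseteq> N \<Longrightarrow> card A = j \<Longrightarrow> f A = g A) \<Longrightarrow> layer_mean f N j = layer_mean g N j"
  unfolding layer_mean_def by (rule arg_cong[of _ _ "\<lambda>s. s / _"]) (auto intro: sum.cong)

lemma layer_mean_ge:
  assumes "finite N" "j \<le> card N" and c: "\<And>A. A \<subseteq> N \<Longrightarrow> card A = j \<Longrightarrow> c \<le> g A"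
  shows "c \<le> layer_mean g N j"
proof -
  have "real (card N choose j) * c = (\<Sum>A | A \<subseteq> N \<and> card A = j. c)"
    using assms by (simp add: n_subsets)
  also have "\<dots> \<le> (\<Sum>A | A \<subseteq> N \<and> card A = j. g A)"
    using c by (intro sum_mono) auto
  finally show ?thesis using assms(2) by (simp add: layer_mean_def pos_le_divide_eq mult.commute)
qed

lemma sum_layer_mean_remove:
  assumes N: "finite N" and j: "j < card N"
  shows "(\<Sum>u\<in>N. layer_mean g (N - {u}) j) = real (card N) * layer_mean g N j"
proof -
  let ?D = "card N" and ?L = "{A. A \<subseteq> N \<and> card A = j}"
  have "(\<Sum>u\<in>N. \<Sum>A | A \<subseteq> N - {u} \<and> card A = j. g A) = (\<Sum>u\<in>N. \<Sum>A | A \<in> ?L \<and> u \<notin> A. g A)"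
    by (intro sum.cong) auto
  also have "\<dots> = (\<Sum>A\<in>?L. \<Sum>u | u \<in> N \<and> u \<notin> A. g A)"
    using N by (intro sum.swap_restrict) auto
  also have "\<dots> = (\<Sum>A\<in>?L. real (?D - j) * g A)"
  proof (rule sum.cong[OF refl])
    fix A assume A: "A \<in> ?L"
    have "{u. u \<in> N \<and> u \<notin> A} = N - A" by auto
    moreover have "finite A" using A N finite_subset by auto
    ultimately show "(\<Sum>u | u \<in> N \<and> u \<notin> A. g A) = real (?D - j) * g A"
      using A by (simp add: card_Diff_subset)
  qed
  finally have double_count: "(\<Sum>u\<in>N. \<Sum>A | A \<subseteq> N - {u} \<and> card A = j. g A) = real (?D - j) * (\<Sum>A\<in>?L. g A)"
    by (simp add: sum_distrib_left)
  have "real (?D - j) * real (?D choose j) = real ?D * real ((?D - 1) choose j)"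
    using binomial_absorb_comp[of ?D j] by (metis of_nat_mult)
  moreover have "(?D choose j) > 0" "((?D - 1) choose j) > 0" using j by simp_all
  ultimately have "real (?D - j) / real ((?D - 1) choose j) = real ?D / real (?D choose j)"
    by (simp add: frac_eq_eq)
  then have "real (?D - j) * (\<Sum>A\<in>?L. g A) / real ((?D - 1) choose j) = real ?D * layer_mean g N j"
    by (simp add: layer_mean_def del: One_nat_def flip: times_divide_eq_left)
  then show ?thesis
    using N double_count by (simp add: layer_mean_def sum_divide_distrib[symmetric])
qed

lemma sum_subset_mean_remove:
  assumes "finite N"
  shows "(\<Sum>u\<in>N. subset_mean g (N - {u})) = (real (card N) + 1) * subset_mean g N - g N"
proof (cases "N = {}")
  case True
  then show ?thesis using layer_mean_card[of N g] by (simp add: subset_mean_def)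
next
  case False
  then obtain n where n: "card N = Suc n"
    using assms by (metis card_eq_0_iff not0_implies_Suc)
  have "(\<Sum>u\<in>N. subset_mean g (N - {u})) = (\<Sum>u\<in>N. (\<Sum>j\<le>n. layer_mean g (N - {u}) j) / real (card N))"
    using n by (intro sum.cong) (auto simp: subset_mean_def)
  also have "\<dots> = (\<Sum>j\<le>n. \<Sum>u\<in>N. layer_mean g (N - {u}) j) / real (card N)"
    unfolding sum_divide_distrib[symmetric] by (subst sum.swap) rule
  also have "\<dots> = (\<Sum>j\<le>n. real (card N) * layer_mean g N j) / real (card N)"
    using assms n by (simp add: sum_layer_mean_remove)
  also have "\<dots> = (\<Sum>j\<le>n. layer_mean g N j)"
    using n by (simp add: sum_distrib_left[symmetric])
  also have "\<dots> = (\<Sum>j\<le>card N. layer_mean g N j) - g N"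
    using layer_mean_card[OF assms, of g] by (simp add: n)
  finally show ?thesis by (simp add: subset_mean_def)
qed

lemma sum_subset_mean_remove_superset:
  assumes "finite X" "N \<subseteq> X"
  shows "(\<Sum>u\<in>X. subset_mean g (N - {u})) = (real (card X) + 1) * subset_mean g N - g N"
proof -
  have fin: "finite N" using assms finite_subset by blast
  have "(\<Sum>u\<in>X. subset_mean g (N - {u})) =
      (\<Sum>u\<in>X - N. subset_mean g (N - {u})) + (\<Sum>u\<in>N. subset_mean g (N - {u}))"
    using assms by (rule sum.subset_diff[rotated])
  also have "(\<Sum>u\<in>X - N. subset_mean g (N - {u})) = (real (card X) - real (card N)) * subset_mean g N"
    using assms fin by (simp add: card_Diff_subset of_nat_diff card_mono)
  finally show ?thesis
    using sum_subset_mean_remove[OF fin, of g] by (simp add: algebra_simps)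
qed

lemma subset_mean_ge:
  assumes "\<And>j. j \<le> card N \<Longrightarrow> b j \<le> layer_mean g N j"
  shows "(\<Sum>j\<le>card N. b j) \<le> (real (card N) + 1) * subset_mean g N"
  using sum_mono[of "{..card N}" b "layer_mean g N"] assms by (simp add: subset_mean_def)

definition nbrs :: "('v \<times> 'v) set \<Rightarrow> 'v set \<Rightarrow> 'v \<Rightarrow> 'v set" where
  "nbrs r W v = {u \<in> W. u \<noteq> v \<and> (v, u) \<in> r}"

lemma nbrs_remove: "nbrs r (W - {u}) v = nbrs r W v - {u}"
  by (auto simp: nbrs_def)

lemma nbrs_remove_self: "nbrs r (W - {v}) v = nbrs r W v"
  by (auto simp: nbrs_def)

lemma nbrs_subset: "nbrs r W v \<subseteq> W - {v}"
  by (auto simp: nbrs_def)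

lemma sum_subset_mean_nbrs_remove:
  assumes W: "finite W"
  shows "(\<Sum>v\<in>W. \<Sum>u\<in>W - {v}. subset_mean g (nbrs r (W - {v}) u)) =
    (\<Sum>u\<in>W. real (card W) * subset_mean g (nbrs r W u) - g (nbrs r W u))"
proof -
  have "(\<Sum>v\<in>W. \<Sum>u\<in>W - {v}. subset_mean g (nbrs r (W - {v}) u)) =
      (\<Sum>v\<in>W. \<Sum>u | u \<in> W \<and> u \<noteq> v. subset_mean g (nbrs r W u - {v}))"
    by (intro sum.cong) (auto simp: nbrs_remove)
  also have "\<dots> = (\<Sum>u\<in>W. \<Sum>v | v \<in> W \<and> u \<noteq> v. subset_mean g (nbrs r W u - {v}))"
    by (rule sum.swap_restrict[OF W W])
  also have "\<dots> = (\<Sum>u\<in>W. \<Sum>v\<in>W - {u}. subset_mean g (nbrs r W u - {v}))"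
    by (intro sum.cong) auto
  also have "\<dots> = (\<Sum>u\<in>W. real (card W) * subset_mean g (nbrs r W u) - g (nbrs r W u))"
  proof (rule sum.cong[OF refl])
    fix u assume "u \<in> W"
    then have "real (card (W - {u})) + 1 = real (card W)"
      using card_Suc_Diff1[OF W] by (metis of_nat_Suc add.commute)
    then show "(\<Sum>v\<in>W - {u}. subset_mean g (nbrs r W u - {v})) =
        real (card W) * subset_mean g (nbrs r W u) - g (nbrs r W u)"
      using sum_subset_mean_remove_superset[OF _ nbrs_subset[of r W u], of g] W by simp
  qed
  finally show ?thesis .
qed

text \<open>Instead of averaging over orders, average over the choice of the last vertex and recurse.\<close>

lemma sum_subset_mean_nbrs_le:
  fixes \<rho> :: "'v set \<Rightarrow> real"
  assumes empty: "0 \<le> \<rho> {}"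
    and insert: "\<And>W v. v \<notin> W \<Longrightarrow> \<rho> W + g (nbrs r W v) \<le> \<rho> (insert v W)"
    and "finite W"
  shows "(\<Sum>v\<in>W. subset_mean g (nbrs r W v)) \<le> \<rho> W"
  using \<open>finite W\<close>
proof (induction W rule: finite_psubset_induct)
  case (psubset W)
  show ?case
  proof (cases "W = {}")
    case True
    then show ?thesis using empty by simp
  next
    case False
    have last: "g (nbrs r W v) + (\<Sum>u\<in>W - {v}. subset_mean g (nbrs r (W - {v}) u)) \<le> \<rho> W" if "v \<in> W" for v
    proof -
      have "\<rho> (W - {v}) + g (nbrs r W v) \<le> \<rho> W"
        using insert[of v "W - {v}"] that by (simp add: nbrs_remove_self insert_absorb)
      moreover have "(\<Sum>u\<in>W - {v}. subset_mean g (nbrs r (W - {v}) u)) \<le> \<rho> (W - {v})"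
        using that by (intro psubset.IH) auto
      ultimately show ?thesis by linarith
    qed
    have "real (card W) * (\<Sum>v\<in>W. subset_mean g (nbrs r W v))
        = (\<Sum>v\<in>W. g (nbrs r W v) + (\<Sum>u\<in>W - {v}. subset_mean g (nbrs r (W - {v}) u)))"
      using psubset.hyps
      by (simp add: sum.distrib sum_subset_mean_nbrs_remove sum_subtractf sum_distrib_left)
    also have "\<dots> \<le> real (card W) * \<rho> W"
      using last by (rule sum_bounded_above)
    finally show ?thesis using False psubset.hyps by (simp add: card_gt_0_iff)
  qed
qed

section \<open>Connectivity of vertex subsets\<close>

definition clique :: "('v \<times> 'v) set \<Rightarrow> 'v set \<Rightarrow> bool" where
  "clique r A \<longleftrightarrow> A \<times> A \<subseteq> r"

lemma clique_subset: "clique r A \<Longrightarrow> B \<subseteq> A \<Longrightarrow> clique r B"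
  unfolding clique_def by blast

text \<open>\<open>k\<close>-connectivity of the subgraph induced on \<open>W\<close>, stated without paths.\<close>

definition cut_connected :: "('v \<times> 'v) set \<Rightarrow> nat \<Rightarrow> 'v set \<Rightarrow> bool" where
  "cut_connected r k W \<longleftrightarrow> k < card W \<and>
     (\<forall>A B. A \<noteq> {} \<longrightarrow> B \<noteq> {} \<longrightarrow> A \<union> B \<subseteq> W \<longrightarrow> A \<times> B \<inter> r = {} \<longrightarrow> k \<le> card (W - (A \<union> B)))"

lemma cut_connectedD:
  "\<lbrakk>cut_connected r k W; A \<noteq> {}; B \<noteq> {}; A \<union> B \<subseteq> W; A \<times> B \<inter> r = {}\<rbrakk> \<Longrightarrow> k \<le> card (W - (A \<union> B))"
  unfolding cut_connected_def by simp

lemma cut_connected_imp_finite: "cut_connected r k W \<Longrightarrow> finite W"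
  unfolding cut_connected_def by (metis card.infinite not_less_zero)

lemma cut_connected_card_nbrs:
  assumes W: "cut_connected r k W" and v: "v \<in> W"
  shows "k \<le> card (nbrs r W v)"
proof (cases "nbrs r W v = W - {v}")
  case True
  moreover have "k < card W" using W by (simp add: cut_connected_def)
  ultimately show ?thesis using v cut_connected_imp_finite[OF W] by simp
next
  case False
  let ?B = "W - {v} - nbrs r W v"
  have "k \<le> card (W - ({v} \<union> ?B))"
    using W v False by (intro cut_connectedD) (auto simp: nbrs_def)
  also have "W - ({v} \<union> ?B) = nbrs r W v" by (auto simp: nbrs_def)
  finally show ?thesis .
qed

lemma cut_connected_remove_simplicial:
  assumes "sym r" and W: "cut_connected r k W" and v: "v \<in> W" and simplicial: "clique r (nbrs r W v)"
    and nc: "\<not> clique r (W - {v})"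
  shows "cut_connected r k (W - {v})"
proof -
  have "nbrs r W v \<subset> W - {v}"
    using simplicial nc nbrs_subset[of r W v] by (metis psubsetI)
  then have "card (nbrs r W v) < card (W - {v})"
    using cut_connected_imp_finite[OF W] by (simp add: psubset_card_mono)
  then have "k < card (W - {v})" using cut_connected_card_nbrs[OF W v] by simp
  moreover have "k \<le> card (W - {v} - (A \<union> B))"
    if AB: "A \<noteq> {}" "B \<noteq> {}" "A \<union> B \<subseteq> W - {v}" "A \<times> B \<inter> r = {}" for A B
  proof -
    have avoid: "k \<le> card (W - {v} - (A \<union> B))"
      if "A \<noteq> {}" "B \<noteq> {}" "A \<union> B \<subseteq> W - {v}" "A \<times> B \<inter> r = {}" "nbrs r W v \<inter> B = {}" for A B
    proof -
      have "k \<le> card (W - (insert v A \<union> B))"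
        using W v that by (intro cut_connectedD) (auto simp: nbrs_def)
      also have "W - (insert v A \<union> B) = W - {v} - (A \<union> B)" by auto
      finally show ?thesis .
    qed
    have "nbrs r W v \<inter> B = {} \<or> nbrs r W v \<inter> A = {}"
      using simplicial AB unfolding clique_def by blast
    moreover have "B \<times> A \<inter> r = {}" using AB(4) \<open>sym r\<close> by (auto dest: symD)
    ultimately show ?thesis using avoid[of A B] avoid[of B A] AB by (metis Un_commute)
  qed
  ultimately show ?thesis unfolding cut_connected_def by simp
qed

lemma cut_connected_if_vertex_connected:
  assumes E: "vertex_connected k E" and r: "refl r" "adjacency E \<subseteq> r"
  shows "cut_connected r k UNIV"
  unfolding cut_connected_def
proof (intro conjI allI impI)
  show "k < CARD('a)" using E by (simp add: vertex_connected_def)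
  fix A B :: "'a set"
  assume "A \<noteq> {}" "B \<noteq> {}" and sep: "A \<times> B \<inter> r = {}"
  then obtain a b where ab: "a \<in> A" "b \<in> B" by blast
  show "k \<le> card (UNIV - (A \<union> B))"
  proof (rule ccontr)
    assume "\<not> k \<le> card (UNIV - (A \<union> B))"
    then have "induced_connected E (A \<union> B)"
      using E unfolding vertex_connected_def by (metis Compl_eq_Diff_UNIV double_complement not_le)
    then have "(a, b) \<in> {(x, y). x \<in> A \<union> B \<and> y \<in> A \<union> B \<and> {x, y} \<in> E}\<^sup>*"
      using ab unfolding induced_connected_def by simp
    then have "b \<in> A"
    proof (induction rule: rtrancl_induct)
      case (step y z)
      then have "(y, z) \<in> r" using r(2) by (auto simp: adjacency_def)
      then show ?case using step sep by auto
    qed (rule ab)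
    then show False using sep ab r(1) by (auto dest: refl_onD)
  qed
qed

section \<open>Graphs in which cliques can be glued\<close>

lemma sum_min_atMost:
  fixes c D :: nat
  assumes "c \<le> D"
  shows "(\<Sum>j\<le>D. real (min j c)) = real c * (real D + 1) - real c * (real c + 1) / 2"
  using assms
proof (induction D rule: dec_induct)
  case base
  have "(\<Sum>j\<le>c. real (min j c)) = (\<Sum>j\<le>c. real j)"
    by (intro sum.cong) auto
  also have "\<dots> = real c * (real c + 1) / 2"
    by (induction c) (auto simp: field_simps)
  finally show ?case by (simp add: field_simps)
next
  case (step n)
  then show ?case by (simp add: field_simps)
qed

lemma sum_greaterThan_atMost:
  fixes c D :: nat
  assumes "c \<le> D"
  shows "(\<Sum>j\<le>D. if c < j then real j else 0) = (real D * (real D + 1) - real c * (real c + 1)) / 2"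
  using assms
proof (induction D rule: dec_induct)
  case base
  have "(\<Sum>j\<le>c. if c < j then real j else 0) = 0"
    by (intro sum.neutral) auto
  then show ?case by simp
next
  case (step n)
  then show ?case by (simp add: field_simps)
qed

lemma rank_density_above:
  assumes "d < k"
  shows "rank_density d k = real d + 1 / 2 - real d * (real d + 1) / (2 * real k)"
  using assms by (auto simp: rank_density_def field_simps)

lemma rank_density_mono:
  assumes "d < k" "k \<le> D"
  shows "rank_density d k \<le> rank_density d D"
proof -
  have "real d * (real d + 1) / (2 * real D) \<le> real d * (real d + 1) / (2 * real k)"
    using assms by (intro divide_left_mono) auto
  then show ?thesis using assms by (simp add: rank_density_above)
qed

lemma rank_density_le:
  assumes "k < d * (d + 1)"
  shows "rank_density d k \<le> real d"
proof (cases "d < k")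
  case True
  have "real k < real d * (real d + 1)"
    using assms by (metis of_nat_1 of_nat_add of_nat_less_iff of_nat_mult)
  then show ?thesis using True by (simp add: rank_density_above field_simps)
qed (simp add: rank_density_def)

definition gain :: "('v \<times> 'v) set \<Rightarrow> nat \<Rightarrow> 'v set \<Rightarrow> nat" where
  "gain r d A = min (card A) d + of_bool (d < card A \<and> \<not> clique r A)"

locale clique_gluing =
  fixes adj :: "('v \<times> 'v) set" and d :: nat
  assumes sym_adj: "sym adj"
    and refl_adj: "refl adj"
    and clique_Un: "\<lbrakk>clique adj A; clique adj B; d \<le> card (A \<inter> B)\<rbrakk> \<Longrightarrow> clique adj (A \<union> B)"
begin

lemma clique_insert_nbrs: "clique adj (nbrs adj W v) \<Longrightarrow> clique adj (insert v (nbrs adj W v))"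
  using sym_adj refl_adj by (auto simp: clique_def nbrs_def dest: symD refl_onD)

lemma not_clique_remove_simplicial:
  assumes nc: "\<not> clique adj W" and v: "v \<in> W" "clique adj (nbrs adj W v)" "d \<le> card (nbrs adj W v)"
  shows "\<not> clique adj (W - {v})"
proof
  assume "clique adj (W - {v})"
  moreover have "(W - {v}) \<inter> insert v (nbrs adj W v) = nbrs adj W v" by (auto simp: nbrs_def)
  ultimately have "clique adj ((W - {v}) \<union> insert v (nbrs adj W v))"
    using v clique_insert_nbrs by (intro clique_Un) simp_all
  then have "clique adj W" by (rule clique_subset) auto
  then show False using nc by blast
qed

lemma clique_remove_unique:
  assumes N: "finite N" "d + 2 \<le> card N" "\<not> clique adj N"
    and x: "x \<in> N" "clique adj (N - {x})" and y: "y \<in> N" "clique adj (N - {y})"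
  shows "x = y"
proof (rule ccontr)
  assume ne: "x \<noteq> y"
  have "(N - {x}) \<inter> (N - {y}) = N - {x, y}" by auto
  then have "card ((N - {x}) \<inter> (N - {y})) = card N - 2"
    using x y ne N by (simp add: card_Diff_subset)
  then have "clique adj ((N - {x}) \<union> (N - {y}))"
    using x y N by (intro clique_Un) auto
  moreover have "(N - {x}) \<union> (N - {y}) = N" using ne by auto
  ultimately show False using N by simp
qed

lemma not_clique_remove_all_but_one:
  assumes N: "finite N" "d + 2 \<le> card N" "\<not> clique adj N"
  obtains x where "x \<in> N" "\<And>u. u \<in> N - {x} \<Longrightarrow> \<not> clique adj (N - {u})"
proof (cases "\<exists>x\<in>N. clique adj (N - {x})")
  case True
  then obtain x where "x \<in> N" "clique adj (N - {x})" by blast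
  then show ?thesis using that[of x] clique_remove_unique[OF N] by blast
next
  case False
  moreover obtain x where "x \<in> N" using N(2) by fastforce
  ultimately show ?thesis using that[of x] by blast
qed

text \<open>At most one vertex of a non-clique \<open>N\<close> leaves a clique when it is deleted, so the bound for \<open>N\<close>
  follows by averaging the bounds for the sets \<open>N - {u}\<close>.\<close>

lemma layer_mean_nonclique_ge:
  assumes "finite N" "\<not> clique adj N" "d < j" "j \<le> card N"
  shows "real j / real (card N) \<le> layer_mean (\<lambda>A. of_bool (\<not> clique adj A)) N j"
  using assms
proof (induction N rule: finite_psubset_induct)
  case (psubset N)
  let ?g = "\<lambda>A. of_bool (\<not> clique adj A) :: real"
  show ?case
  proof (cases "j = card N")
    case True
    then show ?thesis using psubset by (simp add: layer_mean_card)
  next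
    case False
    then have j: "j < card N" using psubset.prems by simp
    obtain x where x: "x \<in> N" "\<And>u. u \<in> N - {x} \<Longrightarrow> \<not> clique adj (N - {u})"
      using psubset j by (elim not_clique_remove_all_but_one) auto
    have "real j = (\<Sum>u\<in>N - {x}. real j / real (card (N - {u})))"
      using x(1) j psubset by (simp add: field_simps)
    also have "\<dots> \<le> (\<Sum>u\<in>N - {x}. layer_mean ?g (N - {u}) j)"
      using x psubset j by (intro sum_mono psubset.IH) auto
    also have "\<dots> \<le> (\<Sum>u\<in>N. layer_mean ?g (N - {u}) j)"
      using psubset.hyps
      by (intro sum_mono2) (auto simp: layer_mean_def intro!: divide_nonneg_nonneg sum_nonneg)
    also have "\<dots> = real (card N) * layer_mean ?g N j"
      by (rule sum_layer_mean_remove[OF psubset.hyps j])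
    finally show ?thesis using j by (simp add: field_simps)
  qed
qed

lemma subset_mean_gain_ge_half:
  assumes "finite N" "k \<le> d" "k \<le> card N"
  shows "real k / 2 \<le> subset_mean (\<lambda>A. real (gain adj d A)) N"
proof -
  let ?D = "real (card N)"
  have "real k * (real k + 1) \<le> real k * (?D + 1)"
    using assms by (simp add: mult_left_mono)
  then have "(?D + 1) * (real k / 2) \<le> (\<Sum>j\<le>card N. real (min j k))"
    unfolding sum_min_atMost[OF assms(3)] by (simp add: field_simps)
  also have "\<dots> \<le> (?D + 1) * subset_mean (\<lambda>A. real (gain adj d A)) N"
    using assms by (intro subset_mean_ge layer_mean_ge) (auto simp: gain_def)
  finally show ?thesis by simp
qed

lemma layer_mean_gain_ge:
  assumes N: "finite N" "\<not> clique adj N" and j: "j \<le> card N"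
  shows "real (min j d) + (if d < j then real j else 0) / real (card N)
    \<le> layer_mean (\<lambda>A. real (gain adj d A)) N j"
proof (cases "d < j")
  case True
  have "layer_mean (\<lambda>A. real (gain adj d A)) N j
      = layer_mean (\<lambda>A. real d) N j + layer_mean (\<lambda>A. of_bool (\<not> clique adj A)) N j"
    unfolding layer_mean_add[symmetric] using True by (intro layer_mean_cong) (simp add: gain_def)
  moreover have "real d \<le> layer_mean (\<lambda>A. real d) N j"
    using N j by (intro layer_mean_ge) auto
  ultimately show ?thesis using layer_mean_nonclique_ge[OF N True j] True by simp
next
  case False
  then show ?thesis using N j by (auto intro: layer_mean_ge simp: gain_def)
qed

lemma subset_mean_gain_ge_rank_density:
  assumes N: "finite N" "\<not> clique adj N" and D: "d < card N"
  shows "rank_density d (card N) \<le> subset_mean (\<lambda>A. real (gain adj d A)) N"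
proof -
  let ?D = "real (card N)"
  have "?D > 0" using D by simp
  then have "(?D + 1) * rank_density d (card N)
      = (real d * (?D + 1) - real d * (real d + 1) / 2)
        + (?D * (?D + 1) - real d * (real d + 1)) / 2 / ?D"
    using D by (simp add: rank_density_above field_simps)
  also have "\<dots> = (\<Sum>j\<le>card N. real (min j d) + (if d < j then real j else 0) / ?D)"
    using D unfolding sum.distrib sum_divide_distrib[symmetric]
    by (simp add: sum_min_atMost sum_greaterThan_atMost)
  also have "\<dots> \<le> (?D + 1) * subset_mean (\<lambda>A. real (gain adj d A)) N"
    by (rule subset_mean_ge[OF layer_mean_gain_ge[OF N]])
  finally show ?thesis using \<open>?D > 0\<close> by simp
qed

lemma rank_density_le_subset_mean_gain:
  assumes N: "finite N" "k \<le> card N" and k: "k \<le> d \<or> \<not> clique adj N"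
  shows "rank_density d k \<le> subset_mean (\<lambda>A. real (gain adj d A)) N"
proof (cases "k \<le> d")
  case True
  then show ?thesis using subset_mean_gain_ge_half N by (simp add: rank_density_def)
next
  case False
  then have "rank_density d k \<le> rank_density d (card N)"
    using N by (intro rank_density_mono) auto
  also have "\<dots> \<le> subset_mean (\<lambda>A. real (gain adj d A)) N"
    using False N k by (intro subset_mean_gain_ge_rank_density) auto
  finally show ?thesis .
qed

text \<open>A vertex whose neighbourhood is a clique may gain too little in a random order; it is put last.\<close>

lemma rank_density_mult_card_le:
  fixes \<rho> :: "'v set \<Rightarrow> nat"
  assumes \<rho>: "\<And>W v. v \<notin> W \<Longrightarrow> \<rho> W + gain adj d (nbrs adj W v) \<le> \<rho> (insert v W)"
    and k: "k < d * (d + 1)"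
    and W: "cut_connected adj k W" "\<not> clique adj W"
  shows "rank_density d k * real (card W) \<le> real (\<rho> W)"
  using cut_connected_imp_finite[OF W(1)] W
proof (induction W rule: finite_psubset_induct)
  case (psubset W)
  note deg = cut_connected_card_nbrs[OF psubset.prems(1)]
  show ?case
  proof (cases "\<exists>v\<in>W. d < k \<and> clique adj (nbrs adj W v)")
    case True
    then obtain v where v: "v \<in> W" "d < k" "clique adj (nbrs adj W v)" by blast
    have nc: "\<not> clique adj (W - {v})"
      using v deg[OF v(1)] psubset.prems(2) by (intro not_clique_remove_simplicial) auto
    have "rank_density d k * real (card (W - {v})) \<le> real (\<rho> (W - {v}))"
      using v nc cut_connected_remove_simplicial[OF sym_adj psubset.prems(1) v(1,3) nc]
      by (intro psubset.IH) auto
    moreover have "\<rho> (W - {v}) + d \<le> \<rho> W"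
      using \<rho>[of v "W - {v}"] v deg[OF v(1)] by (simp add: nbrs_remove_self insert_absorb gain_def)
    moreover have "real (card W) = real (card (W - {v})) + 1"
      using card_Suc_Diff1[OF psubset.hyps v(1)] by simp
    ultimately show ?thesis using rank_density_le[OF k] by (simp add: distrib_left)
  next
    case False
    have "rank_density d k * real (card W) = (\<Sum>v\<in>W. rank_density d k)" by simp
    also have "\<dots> \<le> (\<Sum>v\<in>W. subset_mean (\<lambda>A. real (gain adj d A)) (nbrs adj W v))"
      using False deg psubset.hyps
      by (intro sum_mono rank_density_le_subset_mean_gain)
        (auto intro: finite_subset[OF nbrs_subset])
    also have "\<dots> \<le> real (\<rho> W)"
      using \<rho> psubset.hyps by (intro sum_subset_mean_nbrs_le) (simp_all flip: of_nat_add)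
    finally show ?thesis .
  qed
qed

end

section \<open>Gluing cliques of the closure\<close>

definition row_closure :: "('v::finite \<Rightarrow> real^'d) \<Rightarrow> ('v \<times> 'v) set \<Rightarrow> ('v \<times> 'v) set" where
  "row_closure p r = {(u, v). rigidity_row p u v \<in> span (rigidity_rows p r)}"

lemma rigidity_rows_subset_span_iff: "rigidity_rows p s \<subseteq> span (rigidity_rows p r) \<longleftrightarrow> s \<subseteq> row_closure p r"
  by (auto simp: rigidity_rows_def row_closure_def)

lemma subset_row_closure: "r \<subseteq> row_closure p r"
  using span_superset by (simp flip: rigidity_rows_subset_span_iff)

lemma dim_rigidity_rows_row_closure: "dim (rigidity_rows p (row_closure p r)) = dim (rigidity_rows p r)"
proof (rule antisym)
  show "dim (rigidity_rows p (row_closure p r)) \<le> dim (rigidity_rows p r)"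
    by (rule dim_mono) (simp add: rigidity_rows_subset_span_iff)
  show "dim (rigidity_rows p r) \<le> dim (rigidity_rows p (row_closure p r))"
    by (intro dim_subset rigidity_rows_mono subset_row_closure)
qed

lemma generic_affine_independent:
  fixes p :: "'v::finite \<Rightarrow> real^'d"
  assumes p: "generic_placement p" and P: "card P \<le> CARD('d) + 1"
    and sums: "(\<Sum>i\<in>P. \<mu> i) = 0" "(\<Sum>i\<in>P. \<mu> i *\<^sub>R p i) = 0"
    and i: "i \<in> P"
  shows "\<mu> i = 0"
proof -
  have "(\<Sum>j\<in>P. \<mu> j *\<^sub>R (p i - p j)) = (\<Sum>j\<in>P. \<mu> j) *\<^sub>R p i - (\<Sum>j\<in>P. \<mu> j *\<^sub>R p j)"
    by (simp add: scaleR_right_diff_distrib sum_subtractf scaleR_sum_left)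
  then have "(\<Sum>j\<in>P - {i}. \<mu> j *\<^sub>R (p i - p j)) = 0"
    using sums i by (simp add: sum.remove[of P i])
  moreover have "indep_family (P - {i}) (\<lambda>j. p i - p j)"
    using dim_generic_differences[OF p, of "P - {i}" i] P i by (simp add: indep_family_iff_dim)
  ultimately have "\<mu> j = 0" if "j \<in> P - {i}" for j using that by (intro indep_familyD)
  then show ?thesis using sums(1) i by (simp add: sum.remove[of P i])
qed

lemma ex_affine_dependence:
  fixes p :: "'i \<Rightarrow> 'a::euclidean_space"
  assumes P: "finite P" "DIM('a) + 2 \<le> card P"
  obtains \<mu> i where "(\<Sum>i\<in>P. \<mu> i) = 0" "(\<Sum>i\<in>P. \<mu> i *\<^sub>R p i) = 0" "i \<in> P" "\<mu> i \<noteq> 0"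
proof -
  obtain a where a: "a \<in> P" using P by fastforce
  let ?Q = "P - {a}"
  have "dim ((\<lambda>i. p i - p a) ` ?Q) < card ?Q"
    using dim_subset_UNIV[of "(\<lambda>i. p i - p a) ` ?Q"] P a by simp
  then have "\<not> indep_family ?Q (\<lambda>i. p i - p a)" using P(1) by (simp add: indep_family_iff_dim)
  then obtain c i where c: "(\<Sum>i\<in>?Q. c i *\<^sub>R (p i - p a)) = 0" and i: "i \<in> ?Q" "c i \<noteq> 0"
    unfolding indep_family_def by blast
  define \<mu> where "\<mu> = c(a := - (\<Sum>i\<in>?Q. c i))"
  have sum_P: "(\<Sum>i\<in>P. f (\<mu> i) i) = f (- (\<Sum>i\<in>?Q. c i)) a + (\<Sum>i\<in>?Q. f (c i) i)"
    for f :: "real \<Rightarrow> 'i \<Rightarrow> 'b::comm_monoid_add"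
    unfolding sum.remove[OF P(1) a] by (intro arg_cong2[of _ _ _ _ "(+)"] sum.cong) (auto simp: \<mu>_def)
  have "(\<Sum>i\<in>P. \<mu> i *\<^sub>R p i) = (\<Sum>i\<in>?Q. c i *\<^sub>R (p i - p a))"
    using sum_P[of "\<lambda>m i. m *\<^sub>R p i"]
    by (simp add: scaleR_right_diff_distrib sum_subtractf scaleR_sum_left)
  moreover have "(\<Sum>i\<in>P. \<mu> i) = 0" using sum_P[of "\<lambda>m i. m"] by simp
  moreover have "i \<in> P" "\<mu> i \<noteq> 0" using i by (auto simp: \<mu>_def)
  ultimately show ?thesis using that c by metis
qed

lemma generic_affine_dependence_nonzero:
  fixes p :: "'v::finite \<Rightarrow> real^'d"
  assumes p: "generic_placement p" and P: "card P \<le> CARD('d) + 2"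
    and sums: "(\<Sum>i\<in>P. \<mu> i) = 0" "(\<Sum>i\<in>P. \<mu> i *\<^sub>R p i) = 0"
    and i: "i \<in> P" "\<mu> i \<noteq> 0" and j: "j \<in> P"
  shows "\<mu> j \<noteq> 0"
proof
  assume zero: "\<mu> j = 0"
  then have "(\<Sum>i\<in>P - {j}. \<mu> i) = 0" "(\<Sum>i\<in>P - {j}. \<mu> i *\<^sub>R p i) = 0"
    using sums j by (simp_all add: sum.remove[of P j])
  then have "\<mu> i = 0"
    using P i j zero by (intro generic_affine_independent[OF p, of "P - {j}" \<mu> i]) auto
  then show False using i(2) by simp
qed

lemma equilibrium_stress_of_affine_dependence:
  fixes p :: "'v::finite \<Rightarrow> real^'d"
  assumes sums: "(\<Sum>i\<in>P. \<mu> i) = 0" "(\<Sum>i\<in>P. \<mu> i *\<^sub>R p i) = 0"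
  shows "(\<Sum>i\<in>P. \<Sum>j\<in>P. (\<mu> i * \<mu> j) *\<^sub>R rigidity_row p i j) = 0"
proof -
  have "(\<Sum>j\<in>P. (\<mu> i * \<mu> j) *\<^sub>R at_vertex i (p i - p j)) = 0" for i
  proof -
    have "(\<Sum>j\<in>P. (\<mu> i * \<mu> j) *\<^sub>R at_vertex i (p i - p j)) =
        at_vertex i (\<mu> i *\<^sub>R (\<Sum>j\<in>P. \<mu> j *\<^sub>R (p i - p j)))"
      by (simp add: linear_sum[OF linear_at_vertex] linear_scale[OF linear_at_vertex] scaleR_sum_right)
    moreover have "(\<Sum>j\<in>P. \<mu> j *\<^sub>R (p i - p j)) = 0"
      using sums by (simp add: scaleR_right_diff_distrib sum_subtractf flip: scaleR_sum_left)
    ultimately show ?thesis by (simp add: linear_0[OF linear_at_vertex])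
  qed
  then have half: "(\<Sum>i\<in>P. \<Sum>j\<in>P. (\<mu> i * \<mu> j) *\<^sub>R at_vertex i (p i - p j)) = 0" by simp
  have "(\<Sum>i\<in>P. \<Sum>j\<in>P. (\<mu> i * \<mu> j) *\<^sub>R at_vertex j (p j - p i)) =
      (\<Sum>j\<in>P. \<Sum>i\<in>P. (\<mu> i * \<mu> j) *\<^sub>R at_vertex j (p j - p i))"
    by (rule sum.swap)
  also have "\<dots> = 0" using half by (simp add: mult.commute)
  finally show ?thesis
    using half by (simp add: rigidity_row_def scaleR_add_right sum.distrib)
qed

text \<open>The \<open>d + 2\<close> points of \<open>insert a (insert b C)\<close> carry an equilibrium stress that is not zero on \<open>ab\<close>.\<close>

lemma row_closure_glue_clique:
  fixes p :: "'v::finite \<Rightarrow> real^'d"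
  assumes p: "generic_placement p" and C: "card C = CARD('d)" "a \<notin> C" "b \<notin> C" "a \<noteq> b"
    and clique: "clique (row_closure p r) (insert a C)" "clique (row_closure p r) (insert b C)"
  shows "(a, b) \<in> row_closure p r"
proof -
  let ?S = "span (rigidity_rows p r)" and ?P = "insert a (insert b C)" and ?D = "{(a, b), (b, a)}"
  have P: "card ?P = CARD('d) + 2" using C by simp
  obtain \<mu> i where \<mu>: "(\<Sum>i\<in>?P. \<mu> i) = 0" "(\<Sum>i\<in>?P. \<mu> i *\<^sub>R p i) = 0" "i \<in> ?P" "\<mu> i \<noteq> 0"
    using ex_affine_dependence[of ?P p] P by auto
  have "\<mu> a \<noteq> 0" "\<mu> b \<noteq> 0"
    using generic_affine_dependence_nonzero[OF p _ \<mu>] P by simp_all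
  define X where "X = (\<lambda>(i, j). (\<mu> i * \<mu> j) *\<^sub>R rigidity_row p i j)"
  have "(\<Sum>z\<in>?P \<times> ?P. X z) = 0"
    using equilibrium_stress_of_affine_dependence[OF \<mu>(1,2)] by (simp only: X_def sum.cartesian_product)
  then have "(\<Sum>z\<in>?P \<times> ?P - ?D. X z) + (\<Sum>z\<in>?D. X z) = 0"
    using sum.subset_diff[of ?D "?P \<times> ?P" X] by simp
  moreover have "X z \<in> ?S" if "z \<in> ?P \<times> ?P - ?D" for z
    using that clique by (auto simp: clique_def row_closure_def X_def intro!: span_scale)
  then have "(\<Sum>z\<in>?P \<times> ?P - ?D. X z) \<in> ?S" by (intro span_sum)
  ultimately have "(\<Sum>z\<in>?D. X z) \<in> ?S" by (metis eq_neg_iff_add_eq_0 span_neg add.commute)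
  moreover have "(\<Sum>z\<in>?D. X z) = (2 * \<mu> a * \<mu> b) *\<^sub>R rigidity_row p a b"
    using C(4) by (simp add: X_def rigidity_row_commute[of p b a] flip: scaleR_add_left)
  ultimately have "(1 / (2 * \<mu> a * \<mu> b)) *\<^sub>R ((2 * \<mu> a * \<mu> b) *\<^sub>R rigidity_row p a b) \<in> ?S"
    by (metis span_scale)
  then show ?thesis using \<open>\<mu> a \<noteq> 0\<close> \<open>\<mu> b \<noteq> 0\<close> by (simp add: row_closure_def)
qed

lemma clique_gluing_row_closure:
  fixes p :: "'v::finite \<Rightarrow> real^'d"
  assumes p: "generic_placement p"
  shows "clique_gluing (row_closure p r) CARD('d)"
proof
  show "sym (row_closure p r)"
    by (auto simp: sym_def row_closure_def rigidity_row_commute)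
  show refl: "refl (row_closure p r)"
    by (auto simp: refl_on_def row_closure_def span_zero)
  fix A B
  assume A: "clique (row_closure p r) A" and B: "clique (row_closure p r) B"
    and AB: "CARD('d) \<le> card (A \<inter> B)"
  obtain C where C: "C \<subseteq> A \<inter> B" "card C = CARD('d)"
    using AB by (meson obtain_subset_with_card_n)
  have cross: "(a, b) \<in> row_closure p r" if ab: "a \<in> A" "b \<in> B" for a b
  proof (cases "a \<in> B \<or> b \<in> A")
    case True
    then show ?thesis using A B ab by (auto simp: clique_def)
  next
    case False
    show ?thesis
    proof (rule row_closure_glue_clique[OF p C(2)])
      show "a \<notin> C" "b \<notin> C" "a \<noteq> b" using False C ab by auto
      show "clique (row_closure p r) (insert a C)" "clique (row_closure p r) (insert b C)"
        using C ab by (auto intro: clique_subset[OF A] clique_subset[OF B])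
    qed
  qed
  moreover have "(b, a) \<in> row_closure p r" if "a \<in> A" "b \<in> B" for a b
    using cross[OF that] by (simp add: row_closure_def rigidity_row_commute)
  ultimately show "clique (row_closure p r) (A \<union> B)"
    using A B unfolding clique_def by blast
qed

section \<open>Rank increase by extensions\<close>

lemma dim_add_dim_image_le_dim_Un:
  fixes f :: "'a::euclidean_space \<Rightarrow> 'b::euclidean_space"
  assumes f: "linear f" "f ` S \<subseteq> {0}" and "finite T"
  shows "dim S + dim (f ` T) \<le> dim (S \<union> T)"
  using \<open>finite T\<close>
proof (induction T rule: finite_induct)
  case (insert t T)
  show ?case
  proof (cases "f t \<in> span (f ` T)")
    case True
    then have "dim (f ` insert t T) = dim (f ` T)" by (simp add: dim_insert)
    moreover have "dim (S \<union> T) \<le> dim (S \<union> insert t T)" by (intro dim_subset) auto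
    ultimately show ?thesis using insert.IH by linarith
  next
    case False
    have "t \<notin> span (S \<union> T)"
    proof
      assume "t \<in> span (S \<union> T)"
      then have "f t \<in> span (f ` (S \<union> T))"
        using linear_span_image[OF f(1)] by blast
      moreover have "f ` (S \<union> T) \<subseteq> insert 0 (f ` T)" using f(2) by auto
      ultimately show False using False span_mono span_insert_0 by blast
    qed
    then show ?thesis using insert.IH False by (simp add: dim_insert)
  qed
qed simp

lemma dim_rigidity_rows_star_ge:
  fixes p :: "'v::finite \<Rightarrow> real^'d"
  assumes r: "r \<subseteq> (- {v}) \<times> (- {v})" and T: "v \<notin> T"
  shows "dim (rigidity_rows p r) + dim ((\<lambda>u. p v - p u) ` T) \<le> dim (rigidity_rows p (r \<union> {v} \<times> T))"
proof -
  have "vertex_part v (rigidity_row p u w) = 0" if "(u, w) \<in> r" for u w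
  proof (cases "u = w")
    case True
    then show ?thesis by (simp add: linear_0[OF linear_vertex_part])
  next
    case False
    then show ?thesis using that r by (auto simp: vertex_part_rigidity_row)
  qed
  then have "vertex_part v ` rigidity_rows p r \<subseteq> {0}"
    by (auto simp: rigidity_rows_def)
  then have "dim (rigidity_rows p r) + dim (vertex_part v ` rigidity_rows p ({v} \<times> T))
      \<le> dim (rigidity_rows p r \<union> rigidity_rows p ({v} \<times> T))"
    by (intro dim_add_dim_image_le_dim_Un linear_vertex_part) (auto simp: rigidity_rows_def)
  moreover have "vertex_part v ` rigidity_rows p ({v} \<times> T) = (\<lambda>u. p v - p u) ` T"
  proof -
    have "vertex_part v (rigidity_row p v u) = p v - p u" if "u \<in> T" for u
      using that T by (subst vertex_part_rigidity_row) auto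
    moreover have "rigidity_rows p ({v} \<times> T) = rigidity_row p v ` T"
      by (auto simp: rigidity_rows_def)
    ultimately show ?thesis by (simp add: image_image)
  qed
  ultimately show ?thesis by (simp add: rigidity_rows_def image_Un)
qed

lemma zero_extension_rank:
  fixes p :: "'v::finite \<Rightarrow> real^'d"
  assumes p: "generic_placement p" and r: "r \<subseteq> (- {v}) \<times> (- {v})" and N: "v \<notin> N"
  shows "dim (rigidity_rows p r) + min (card N) CARD('d) \<le> dim (rigidity_rows p (r \<union> {v} \<times> N))"
proof -
  obtain T where T: "T \<subseteq> N" "card T = min (card N) CARD('d)"
    by (meson min.cobounded1 obtain_subset_with_card_n)
  have vT: "v \<notin> T" using T N by auto
  have "dim ((\<lambda>u. p v - p u) ` T) = card T"
    using T(2) by (intro dim_generic_differences[OF p _ vT]) simp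
  then have "dim (rigidity_rows p r) + card T \<le> dim (rigidity_rows p (r \<union> {v} \<times> T))"
    using dim_rigidity_rows_star_ge[OF r vT, of p] by simp
  also have "\<dots> \<le> dim (rigidity_rows p (r \<union> {v} \<times> N))"
    using T(1) by (intro dim_subset rigidity_rows_mono) auto
  finally show ?thesis using T(2) by simp
qed

lemma rigidity_rows_cong:
  assumes "\<And>u w. (u, w) \<in> r \<Longrightarrow> p u = q u \<and> p w = q w"
  shows "rigidity_rows p r = rigidity_rows q r"
proof -
  have "rigidity_row p u w = rigidity_row q u w" if "(u, w) \<in> r" for u w
    using assms[OF that] by (simp add: rigidity_row_def)
  then show ?thesis unfolding rigidity_rows_def by (intro image_cong) auto
qed

lemma rigidity_row_midpoint:
  assumes "p v = midpoint (p x) (p y)"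
  shows "rigidity_row p x y = 2 *\<^sub>R (rigidity_row p v x + rigidity_row p v y)"
proof -
  define h where "h = p v - p x"
  have "p x + p y = p v + p v" using assms by (simp add: midpoint_eq_iff)
  then have diffs: "p y - p v = h" "p v - p y = - h" "p x - p v = - h" "p v - p x = h"
      "p y - p x = 2 *\<^sub>R h" "p x - p y = 2 *\<^sub>R (- h)"
    by (simp_all add: h_def scaleR_2 algebra_simps)
  show ?thesis
    unfolding rigidity_row_def diffs
    by (simp add: linear_scale[OF linear_at_vertex] linear_neg[OF linear_at_vertex]
        scaleR_right_diff_distrib)
qed

lemma dim_differences_midpoint:
  fixes f :: "'k \<Rightarrow> 'a::euclidean_space"
  assumes "x \<in> T"
  shows "dim ((\<lambda>u. y - f u) ` T) \<le> dim ((\<lambda>u. midpoint (f x) y - f u) ` T)"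
proof (rule dim_mono, rule image_subsetI)
  fix u assume "u \<in> T"
  have split: "y - f u = (midpoint (f x) y - f u) + (midpoint (f x) y - f x)"
    using midpoint_plus_self[of "f x" y] by (simp add: algebra_simps)
  show "y - f u \<in> span ((\<lambda>u. midpoint (f x) y - f u) ` T)"
    unfolding split using assms \<open>u \<in> T\<close> by (intro span_add span_base imageI)
qed

lemma dim_rigidity_rows_midpoint_le:
  assumes mid: "p v = midpoint (p x) (p y)" and N: "x \<in> N" "y \<in> N" "T \<subseteq> N"
  shows "dim (rigidity_rows p (insert (x, y) r \<union> {v} \<times> T)) \<le> dim (rigidity_rows p (r \<union> {v} \<times> N))"
proof (rule dim_mono)
  let ?s = "r \<union> {v} \<times> N"
  have "(v, x) \<in> row_closure p ?s" "(v, y) \<in> row_closure p ?s"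
    using N subset_row_closure[of ?s p] by auto
  then have "(x, y) \<in> row_closure p ?s"
    by (simp add: row_closure_def rigidity_row_midpoint[OF mid] span_add span_scale
        del: scaleR_add_right)
  then show "rigidity_rows p (insert (x, y) r \<union> {v} \<times> T) \<subseteq> span (rigidity_rows p ?s)"
    unfolding rigidity_rows_subset_span_iff using N(3) subset_row_closure[of ?s p] by auto
qed

text \<open>Moving \<open>v\<close> to the midpoint of \<open>x\<close> and \<open>y\<close> puts the row of \<open>xy\<close> into the span of those of \<open>vx\<close>
  and \<open>vy\<close>.\<close>

lemma one_extension_rank:
  fixes p :: "'v::finite \<Rightarrow> real^'d"
  assumes p: "generic_placement p" and r: "r \<subseteq> (- {v}) \<times> (- {v})" and N: "v \<notin> N" "CARD('d) < card N"
    and xy: "x \<in> N" "y \<in> N" "rigidity_row p x y \<notin> span (rigidity_rows p r)"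
  shows "dim (rigidity_rows p r) + CARD('d) + 1 \<le> dim (rigidity_rows p (r \<union> {v} \<times> N))"
proof -
  obtain T where T: "x \<in> T" "T \<subseteq> N - {y}" "card T = CARD('d)"
  proof -
    have "x \<noteq> y" using xy(3) by (auto simp: span_zero)
    then have "\<exists>T. {x} \<subseteq> T \<and> T \<subseteq> N - {y} \<and> card T = CARD('d)"
      using xy N(2) by (intro exists_subset_between) (auto simp: Suc_le_eq)
    then show ?thesis using that by blast
  qed
  have vT: "v \<notin> T" using T(2) N(1) by auto
  define q where "q = p(v := midpoint (p x) (p y))"
  let ?s = "insert (x, y) r"
  have s: "?s \<subseteq> (- {v}) \<times> (- {v})" using r xy N(1) by auto
  have "dim (rigidity_rows p ?s) = dim (rigidity_rows p r) + 1"
    using xy(3) by (simp add: rigidity_rows_def dim_insert)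
  moreover have "rigidity_rows q ?s = rigidity_rows p ?s"
    using s by (intro rigidity_rows_cong) (auto simp: q_def)
  moreover have "CARD('d) = dim ((\<lambda>u. p y - p u) ` T)"
    using T by (subst dim_generic_differences[OF p]) auto
  moreover have "\<dots> \<le> dim ((\<lambda>u. midpoint (p x) (p y) - p u) ` T)"
    using T(1) by (rule dim_differences_midpoint)
  moreover have "(\<lambda>u. midpoint (p x) (p y) - p u) ` T = (\<lambda>u. q v - q u) ` T"
    using vT by (intro image_cong) (auto simp: q_def)
  ultimately have "dim (rigidity_rows p r) + CARD('d) + 1 \<le> dim (rigidity_rows q (?s \<union> {v} \<times> T))"
    using dim_rigidity_rows_star_ge[OF s vT, of q] by simp
  also have "\<dots> \<le> dim (rigidity_rows q (r \<union> {v} \<times> N))"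
    using xy N(1) T(2) by (intro dim_rigidity_rows_midpoint_le) (auto simp: q_def)
  also have "\<dots> \<le> dim (rigidity_rows p (r \<union> {v} \<times> N))"
    by (rule dim_rigidity_rows_le_generic[OF p])
  finally show ?thesis .
qed

lemma dim_rigidity_rows_closure_insert_ge:
  fixes p :: "'v::finite \<Rightarrow> real^'d" and r :: "('v \<times> 'v) set"
  defines "adj \<equiv> row_closure p r"
  assumes p: "generic_placement p" and v: "v \<notin> W"
  shows "dim (rigidity_rows p (Restr adj W)) + gain adj CARD('d) (nbrs adj W v)
    \<le> dim (rigidity_rows p (Restr adj (insert v W)))"
proof -
  let ?N = "nbrs adj W v"
  have W: "Restr adj W \<subseteq> (- {v}) \<times> (- {v})" "v \<notin> ?N" using v by (auto simp: nbrs_def)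
  have "dim (rigidity_rows p (Restr adj W)) + gain adj CARD('d) ?N
      \<le> dim (rigidity_rows p (Restr adj W \<union> {v} \<times> ?N))"
  proof (cases "CARD('d) < card ?N \<and> \<not> clique adj ?N")
    case True
    then obtain x y where xy: "x \<in> ?N" "y \<in> ?N" "(x, y) \<notin> adj" by (auto simp: clique_def)
    have "rigidity_rows p (Restr adj W) \<subseteq> span (rigidity_rows p r)"
      by (simp add: rigidity_rows_subset_span_iff adj_def)
    then have "rigidity_row p x y \<notin> span (rigidity_rows p (Restr adj W))"
      using xy(3) span_minimal[OF _ subspace_span] by (auto simp: adj_def row_closure_def)
    then show ?thesis
      using one_extension_rank[OF p W _ xy(1,2)] True by (simp add: gain_def)
  next
    case False
    then show ?thesis using zero_extension_rank[OF p W] by (auto simp: gain_def)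
  qed
  also have "\<dots> \<le> dim (rigidity_rows p (Restr adj (insert v W)))"
    by (intro dim_subset rigidity_rows_mono) (auto simp: nbrs_def)
  finally show ?thesis .
qed

lemma rigid_graph_if_clique_row_closure:
  fixes p :: "'v::finite \<Rightarrow> real^'d"
  assumes p: "generic_placement p" and "clique (row_closure p (adjacency E)) UNIV"
  shows "rigid_graph TYPE('d) E"
proof -
  have "rigidity_rows p UNIV \<subseteq> span (rigidity_rows p (adjacency E))"
    using assms(2) by (simp add: rigidity_rows_subset_span_iff clique_def)
  then show ?thesis
    using rigid_framework_if_rows_span[OF p] p unfolding rigid_graph_def by blast
qed

theorem theorem5p2:
  fixes E :: "'v::finite set set" and d k :: nat
  assumes "CARD('d::finite) = d" and "1 \<le> d"
    and "1 \<le> k" and "k < d * (d + 1)"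
    and "simple_graph E"
    and "vertex_connected k E"
    and "\<not> rigid_graph TYPE('d) E"
  shows "real (rigidity_rank TYPE('d) E) \<ge> rank_density d k * real CARD('v)"
proof -
  obtain p :: "'v \<Rightarrow> real^'d" where p: "generic_placement p" using ex_generic_placement by blast
  define adj where "adj = row_closure p (adjacency E)"
  interpret clique_gluing adj d
    unfolding adj_def using clique_gluing_row_closure[OF p] assms(1) by simp
  have "cut_connected adj k UNIV"
    using assms(6) refl_adj
    by (rule cut_connected_if_vertex_connected) (simp add: adj_def subset_row_closure)
  moreover have "\<not> clique adj UNIV"
    using rigid_graph_if_clique_row_closure[OF p] assms(7) by (auto simp: adj_def)
  ultimately have "rank_density d k * real CARD('v) \<le> real (dim (rigidity_rows p (Restr adj UNIV)))"
    using dim_rigidity_rows_closure_insert_ge[OF p] assms(1,4)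
    by (intro rank_density_mult_card_le) (auto simp: adj_def)
  also have "dim (rigidity_rows p (Restr adj UNIV)) = rigidity_rank TYPE('d) E"
    by (simp add: adj_def dim_rigidity_rows_row_closure rigidity_rank_eq[OF assms(5) p])
  finally show ?thesis .
qed

end
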